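(* Let $\varphi$ be a unit in $N^+$ such that $\varphi\mathcal{N}=\{\varphi f: f\in\mathcal{N}\}$ is dense in $H^2$. (i) If $1/\varphi\in H^p$ for some $p\in(2,\infty)$, then $\zeta(s)\ne0$ for $\Re s>\frac12+\frac1p$. (ii) If $1/\varphi\in H^2$, then $\zeta(s)\neq 0$ for $\Re s\ge1$. (iii) If $1/\varphi\in H^\infty$, then $\zeta(s)\ne0$ for $\Re s>\frac12$.
   Context: $\zeta$ is the Riemann zeta function (with its pole at $s=1$; non-vanishing is meant at all other points). $H^p$ are the Hardy spaces of the unit disk $\mathbb{D}$. The Smirnov class $N^+$ consists of all holomorphic functions $g/h$ on $\mathbb{D}$ with $g,h\in H^\infty$ and $h$ outer; it is an algebra under pointwise multiplication, and $\varphi\in N^+$ is a unit if $1/\varphi\in N^+$ (equivalently, $\varphi=g/h$ with $g,h\in H^\infty$ both outer). For $k\ge2$, $$h_k(z)=\frac{1}{1-z}\log\left(\frac{1+z+\dots+z^{k-1}}{k}\right),\quad z\in\mathbb{D},$$ with the holomorphic branch of the logarithm on $\mathbb{D}$ equal to $-\log k\in\mathbb{R}$ at $z=0$; each $h_k$ is known to belong to $H^2$. $\mathcal{N}$ is the linear span of $\{h_k:k\ge2\}$. The phrase "$\varphi\mathcal{N}$ is dense in $H^2$" means that $\varphi\mathcal{N}$ is a dense subset of $H^2$. *)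

theory Defs
  imports "HOL-Complex_Analysis.Complex_Analysis"
begin

section \<open>The Riemann zeta function\<close>

text \<open>The value at the pole \<open>s = 1\<close> is left unspecified; everywhere else the function is
  determined, as shown by \<open>riemann_zeta\<close> and \<open>riemann_zeta_unique\<close> below.\<close>

definition is_riemann_zeta :: "(complex \<Rightarrow> complex) \<Rightarrow> bool" where
  "is_riemann_zeta Z \<longleftrightarrow> Z holomorphic_on - {1} \<and>
     (\<forall>s. Re s > 1 \<longrightarrow> (\<lambda>n. 1 / of_nat (Suc n) powr s) sums Z s)"

definition riemann_zeta :: "complex \<Rightarrow> complex" where
  "riemann_zeta = (SOME Z. is_riemann_zeta Z)"

lemma is_riemann_zeta_unique:
  assumes "is_riemann_zeta Y" "is_riemann_zeta Z" "s \<noteq> 1"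
  shows "Y s = Z s"
proof -
  have hol: "Y holomorphic_on - {1}" "Z holomorphic_on - {1}"
    using assms by (auto simp: is_riemann_zeta_def)
  have "Y w = Z w" if "w \<in> {w. Re w > 1}" for w
    using assms that sums_unique2 unfolding is_riemann_zeta_def by blast
  then show ?thesis
    using hol assms(3)
    by (intro analytic_continuation_open[of "{w. Re w > 1}" "- {1}" Y Z s])
      (auto simp: open_halfspace_Re_gt connected_punctured_universe intro!: exI[of _ 2])
qed

text \<open>Existence: \<open>zeta_aux p n s\<close> is the integral of \<open>p (frac x) * x powr (- s)\<close> over
  \<open>{n + 1..n + 2}\<close>. Integration by parts reduces the continuation of its sum over \<open>n\<close> to that of
  the sum of \<open>zeta_aux q n (s + 1)\<close> for another continuous function \<open>q\<close> on \<open>{0..1}\<close>.\<close>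

definition zeta_aux :: "(real \<Rightarrow> real) \<Rightarrow> nat \<Rightarrow> complex \<Rightarrow> complex" where
  "zeta_aux p n s = integral {0..1}
     (\<lambda>t. of_real (p t) * of_real (t + real (Suc n)) powr (- s))"

lemma continuous_on_zeta_aux_integrand:
  assumes "continuous_on {0..1} p"
  shows "continuous_on {0..1} (\<lambda>t. of_real (p t) * of_real (t + real (Suc n)) powr (- s :: complex))"
  using assms
  by (intro continuous_intros continuous_on_powr_complex)
    (auto simp: complex_nonpos_Reals_iff complex_eq_iff)

lemma zeta_aux_has_integral:
  assumes "continuous_on {0..1} p"
  shows "((\<lambda>t. of_real (p t) * of_real (t + real (Suc n)) powr (- s)) has_integral zeta_aux p n s) {0..1}"
  unfolding zeta_aux_def
  by (intro integrable_integral integrable_continuous_real continuous_on_zeta_aux_integrand assms)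

lemma zeta_aux_holomorphic:
  assumes "continuous_on {0..1} p"
  shows "zeta_aux p n holomorphic_on UNIV"
proof -
  let ?x = "\<lambda>t::real. complex_of_real (t + real (Suc n))"
  have nz: "?x t \<noteq> 0" if "t \<in> {0..1}" for t
    using that by (auto simp: complex_eq_iff)
  have "(\<lambda>s. integral (cbox 0 1) (\<lambda>t. of_real (p t) * ?x t powr (- s))) holomorphic_on UNIV"
  proof (rule leibniz_rule_holomorphic[where fx = "\<lambda>s t. - of_real (p t) * ?x t powr (- s) * Ln (?x t)"])
    fix s :: complex and t :: real
    assume "t \<in> cbox 0 1"
    then have "?x t \<noteq> 0" using nz[of t] by simp
    then show "((\<lambda>s. of_real (p t) * ?x t powr (- s)) has_field_derivative
        - of_real (p t) * ?x t powr (- s) * Ln (?x t)) (at s within UNIV)"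
      by (auto intro!: derivative_eq_intros simp: powr_def simp del: of_nat_Suc of_real_add)
  next
    fix s :: complex
    show "(\<lambda>t. of_real (p t) * ?x t powr (- s)) integrable_on cbox 0 1"
      using integrable_continuous_real[OF continuous_on_zeta_aux_integrand[OF assms]] by simp
  next
    have "continuous_on (UNIV \<times> {0..1}) (\<lambda>y::complex \<times> real. p (snd y))"
      by (rule continuous_on_compose2[OF assms]) (auto intro: continuous_intros)
    then show "continuous_on (UNIV \<times> cbox 0 1)
        (\<lambda>(s, t). - of_real (p t) * ?x t powr (- s) * Ln (?x t))"
      unfolding case_prod_unfold
      by (intro continuous_intros continuous_on_powr_complex)
        (auto simp: complex_nonpos_Reals_iff complex_eq_iff)
  qed auto
  then show ?thesis
    by (simp add: zeta_aux_def[abs_def])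
qed

lemma norm_of_real_powr: "x > 0 \<Longrightarrow> norm (complex_of_real x powr s) = x powr Re s"
  by (simp add: powr_def Ln_of_real)

lemma zeta_aux_bound:
  assumes "continuous_on {0..1} p" "\<And>t. t \<in> {0..1} \<Longrightarrow> \<bar>p t\<bar> \<le> C" "Re s \<ge> 0"
  shows "norm (zeta_aux p n s) \<le> C * real (Suc n) powr (- Re s)"
proof -
  have "norm (zeta_aux p n s) \<le> integral {0..1} (\<lambda>t::real. C * real (Suc n) powr (- Re s))"
    unfolding zeta_aux_def
  proof (rule integral_norm_bound_integral)
    show "(\<lambda>t. of_real (p t) * of_real (t + real (Suc n)) powr (- s)) integrable_on {0..1}"
      by (intro integrable_continuous_real continuous_on_zeta_aux_integrand assms)
    fix t :: real
    assume t: "t \<in> {0..1}"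
    have "norm (of_real (p t) * complex_of_real (t + real (Suc n)) powr (- s))
            = \<bar>p t\<bar> * (t + real (Suc n)) powr (- Re s)"
      using t norm_of_real_powr[of "t + real (Suc n)" "- s"]
      by (simp add: norm_mult del: of_nat_Suc of_real_add)
    also have "\<dots> \<le> C * real (Suc n) powr (- Re s)"
      using t assms(2)[of t] assms(3)
      by (intro mult_mono powr_mono2') auto
    finally show "norm (of_real (p t) * complex_of_real (t + real (Suc n)) powr (- s))
        \<le> C * real (Suc n) powr (- Re s)" .
  qed auto
  then show ?thesis by simp
qed

lemma zeta_aux_sums:
  assumes p: "continuous_on {0..1} p"
  shows "\<exists>g. g holomorphic_on {s. Re s > 1} \<and> (\<forall>s. Re s > 1 \<longrightarrow> (\<lambda>n. zeta_aux p n s) sums g s)"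
proof -
  let ?S = "{s::complex. Re s > 1}"
  have "bounded (p ` {0..1})"
    using p compact_continuous_image compact_imp_bounded by blast
  then obtain C where C: "\<And>t. t \<in> {0..1} \<Longrightarrow> \<bar>p t\<bar> \<le> C" "C > 0"
    unfolding bounded_pos by (metis imageI real_norm_def)
  have S: "open ?S" by (rule open_halfspace_Re_gt)
  have fd: "zeta_aux p n field_differentiable (at s)" for n s
    using zeta_aux_holomorphic[OF p, of n] by (simp add: holomorphic_on_def)
  have bd: "\<exists>d h. 0 < d \<and> summable h \<and> range h \<subseteq> \<real>\<^sub>\<ge>\<^sub>0 \<and>
      (\<forall>\<^sub>F n in sequentially. \<forall>y\<in>ball s d \<inter> ?S. cmod (zeta_aux p n y) \<le> cmod (h n))"
    if s: "s \<in> ?S" for s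
  proof -
    define d where "d = (Re s - 1) / 2"
    define h :: "nat \<Rightarrow> real" where "h = (\<lambda>n. C * real (Suc n) powr (- (1 + d)))"
    have d: "d > 0" using s by (simp add: d_def)
    have "summable (\<lambda>n. real n powr (- (1 + d)))"
      using d by (simp add: summable_real_powr_iff)
    then have "summable (\<lambda>n. real (Suc n) powr (- (1 + d)))"
      by (subst summable_Suc_iff)
    then have "summable h" unfolding h_def by (rule summable_mult)
    then have "summable (\<lambda>n. complex_of_real (h n))" by (rule summable_of_real)
    moreover have hpos: "h n \<ge> 0" for n using C by (simp add: h_def)
    moreover have "cmod (zeta_aux p n y) \<le> h n" if "y \<in> ball s d \<inter> ?S" for n y
    proof -
      have "\<bar>Re (s - y)\<bar> < d" using that abs_Re_le_cmod[of "s - y"] by (auto simp: dist_norm)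
      then have y: "Re y \<ge> 1 + d" by (simp add: d_def abs_if field_simps split: if_splits)
      have "cmod (zeta_aux p n y) \<le> C * real (Suc n) powr (- Re y)"
        using y d by (intro zeta_aux_bound[OF p C(1)]) auto
      also have "\<dots> \<le> h n"
        unfolding h_def using y C by (intro mult_left_mono powr_mono) auto
      finally show ?thesis .
    qed
    ultimately show ?thesis
      using d by (intro exI[of _ d] exI[of _ "\<lambda>n. complex_of_real (h n)"]) auto
  qed
  obtain g where "\<forall>s\<in>?S. (\<lambda>n. zeta_aux p n s) sums g s \<and> g field_differentiable (at s)"
    by (rule series_differentiable_comparison_complex[OF S fd bd]) auto
  then show ?thesis
    by (intro exI[of _ g]) (auto simp: holomorphic_on_def intro: field_differentiable_at_within)
qed

lemma has_vector_derivative_shift_powr: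
  assumes "t \<ge> (0::real)"
  shows "((\<lambda>t. complex_of_real (t + real (Suc n)) powr s) has_vector_derivative
           s * of_real (t + real (Suc n)) powr (s - 1)) (at t within A)"
proof -
  have "((\<lambda>z. (z + of_nat (Suc n)) powr s) has_field_derivative
      s * (of_real t + of_nat (Suc n)) powr (s - 1)) (at (complex_of_real t))"
    using assms by (auto intro!: derivative_eq_intros simp: complex_nonpos_Reals_iff)
  from has_vector_derivative_real_field[OF this, of A] show ?thesis
    by (simp add: o_def)
qed

lemma zeta_aux_by_parts:
  assumes q: "continuous_on {0..1} q" and Q: "continuous_on {0..1} Q"
    and der: "\<And>t. t \<in> {0..1} \<Longrightarrow> (Q has_real_derivative q t) (at t within {0..1})"
  shows "zeta_aux q n s = of_real (Q 1) * of_nat (n + 2) powr (- s)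
           - of_real (Q 0) * of_nat (n + 1) powr (- s) + s * zeta_aux Q n (s + 1)"
proof -
  let ?x = "\<lambda>t::real. complex_of_real (t + real (Suc n))"
  let ?G = "\<lambda>t. of_real (Q t) * ?x t powr (- s)"
  have "((\<lambda>t. of_real (q t) * ?x t powr (- s) - s * (of_real (Q t) * ?x t powr (- (s + 1))))
      has_integral (?G 1 - ?G 0)) {0..1}"
  proof (rule fundamental_theorem_of_calculus)
    fix t :: real assume t: "t \<in> {0..1}"
    have "((\<lambda>t. complex_of_real (Q t)) has_vector_derivative of_real (q t)) (at t within {0..1})"
      using der[OF t] by (simp add: has_vector_derivative_of_real has_real_derivative_iff_has_vector_derivative)
    moreover have "((\<lambda>t. ?x t powr (- s)) has_vector_derivative - s * ?x t powr (- s - 1)) (at t within {0..1})"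
      using has_vector_derivative_shift_powr[of t n "- s"] t by simp
    ultimately have "(?G has_vector_derivative
        of_real (Q t) * (- s * ?x t powr (- s - 1)) + of_real (q t) * ?x t powr (- s)) (at t within {0..1})"
      by (rule has_vector_derivative_mult)
    moreover have "- (s + 1) = - s - 1" by simp
    ultimately show "(?G has_vector_derivative of_real (q t) * ?x t powr (- s)
        - s * (of_real (Q t) * ?x t powr (- (s + 1)))) (at t within {0..1})"
      by (simp only:) (simp add: algebra_simps)
  qed auto
  moreover have "((\<lambda>t. of_real (q t) * ?x t powr (- s) - s * (of_real (Q t) * ?x t powr (- (s + 1))))
      has_integral (zeta_aux q n s - s * zeta_aux Q n (s + 1))) {0..1}"
    by (intro has_integral_diff has_integral_mult_right zeta_aux_has_integral q Q)
  ultimately have "zeta_aux q n s - s * zeta_aux Q n (s + 1) = ?G 1 - ?G 0"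
    using has_integral_unique by blast
  then show ?thesis by (simp add: algebra_simps)
qed

lemma powr_minus_tendsto_0:
  assumes "Re s > 0"
  shows "(\<lambda>n. of_nat (n + 1) powr (- s) :: complex) \<longlonglongrightarrow> 0"
proof -
  have "(\<lambda>n. real (n + 1) powr (- Re s)) \<longlonglongrightarrow> 0"
    using assms by (intro tendsto_neg_powr filterlim_compose[OF filterlim_real_sequentially])
      (auto intro: filterlim_Suc)
  moreover have "norm (of_nat (n + 1) powr (- s) :: complex) = real (n + 1) powr (- Re s)" for n
    using norm_of_real_powr[of "real (n + 1)" "- s"] by (simp del: of_nat_Suc of_nat_add)
  ultimately show ?thesis
    by (subst tendsto_norm_zero_iff[symmetric]) simp
qed

lemma zeta_aux_const_sums:
  assumes "Re s > 1"
  shows "(\<lambda>n. zeta_aux (\<lambda>_. 1) n s) sums (1 / (s - 1))"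
proof -
  have s: "s \<noteq> 1" using assms by auto
  have eq: "zeta_aux (\<lambda>_. 1) n s
      = (of_nat (n + 1) powr (- (s - 1)) - of_nat (Suc n + 1) powr (- (s - 1))) / (s - 1)" for n
  proof -
    have "zeta_aux (\<lambda>_. 0) n (s - 1) = of_nat (n + 2) powr (- (s - 1))
        - of_nat (n + 1) powr (- (s - 1)) + (s - 1) * zeta_aux (\<lambda>_. 1) n s"
      using zeta_aux_by_parts[of "\<lambda>_. 0" "\<lambda>_. 1" n "s - 1"] by simp
    moreover have "zeta_aux (\<lambda>_. 0) n (s - 1) = 0" by (simp add: zeta_aux_def)
    ultimately show ?thesis using s by (simp add: field_simps)
  qed
  have "(\<lambda>n. of_nat (n + 1) powr (- (s - 1)) - of_nat (Suc n + 1) powr (- (s - 1)) :: complex)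
      sums (of_nat (0 + 1) powr (- (s - 1)) - 0)"
    by (intro telescope_sums' powr_minus_tendsto_0) (use assms in auto)
  from sums_divide[OF this, of "s - 1"] show ?thesis
    unfolding eq by simp
qed

lemma zeta_aux_continuation_halfplane:
  assumes "continuous_on {0..1} p"
  shows "\<exists>F. F holomorphic_on {s. Re s > 1 - real N} \<and>
           (\<forall>s. Re s > 1 \<longrightarrow> (\<lambda>n. zeta_aux p n s) sums (F s / (s - 1)))"
  using assms
proof (induction N arbitrary: p)
  case 0
  obtain g where "g holomorphic_on {s. Re s > 1}"
      "\<And>s. Re s > 1 \<Longrightarrow> (\<lambda>n. zeta_aux p n s) sums g s"
    using zeta_aux_sums[OF 0] by blast
  then show ?case
    by (intro exI[of _ "\<lambda>s. (s - 1) * g s"]) (auto intro!: holomorphic_intros)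
next
  case (Suc N)
  define c where "c = integral {0..1} p"
  define q where "q = (\<lambda>t. p t - c)"
  define Q where "Q = (\<lambda>t. integral {0..t} q)"
  have q: "continuous_on {0..1} q"
    unfolding q_def by (intro continuous_intros Suc.prems)
  have der: "(Q has_real_derivative q t) (at t within {0..1})" if "t \<in> {0..1}" for t
    unfolding Q_def by (rule integral_has_real_derivative[OF q that])
  then have Q: "continuous_on {0..1} Q"
    by (meson DERIV_continuous continuous_on_eq_continuous_within)
  have Q0: "Q 0 = 0" by (simp add: Q_def)
  have Q1: "Q 1 = 0"
    unfolding Q_def q_def c_def
    by (subst integral_diff) (use Suc.prems in \<open>auto intro!: integrable_continuous_real\<close>)
  have split: "zeta_aux p n s = of_real c * zeta_aux (\<lambda>_. 1) n s + s * zeta_aux Q n (s + 1)" for n s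
  proof -
    let ?x = "\<lambda>t::real. complex_of_real (t + real (Suc n)) powr (- s)"
    have "((\<lambda>t. of_real c * (of_real 1 * ?x t) + of_real (q t) * ?x t) has_integral
        of_real c * zeta_aux (\<lambda>_. 1) n s + zeta_aux q n s) {0..1}"
      by (intro has_integral_add has_integral_mult_right zeta_aux_has_integral q) auto
    moreover have "(\<lambda>t. of_real c * (of_real 1 * ?x t) + of_real (q t) * ?x t)
        = (\<lambda>t. of_real (p t) * ?x t)"
      by (simp add: q_def algebra_simps)
    ultimately have "((\<lambda>t. of_real (p t) * ?x t) has_integral
        of_real c * zeta_aux (\<lambda>_. 1) n s + zeta_aux q n s) {0..1}"
      by (simp only:)
    then have "zeta_aux p n s = of_real c * zeta_aux (\<lambda>_. 1) n s + zeta_aux q n s"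
      by (rule has_integral_unique[OF zeta_aux_has_integral[OF Suc.prems]])
    then show ?thesis
      using zeta_aux_by_parts[OF q Q der, of n s] by (simp add: Q0 Q1)
  qed
  obtain F where F: "F holomorphic_on {s. Re s > 1 - real N}"
      "\<And>s. Re s > 1 \<Longrightarrow> (\<lambda>n. zeta_aux Q n s) sums (F s / (s - 1))"
    using Suc.IH[OF Q] by blast
  let ?F = "\<lambda>s. of_real c + (s - 1) * F (s + 1)"
  have "(\<lambda>s. F (s + 1)) holomorphic_on {s. Re s > 1 - real (Suc N)}"
    by (rule holomorphic_on_compose_gen[OF _ F(1), unfolded o_def]) (auto intro!: holomorphic_intros)
  then have "?F holomorphic_on {s. Re s > 1 - real (Suc N)}"
    by (intro holomorphic_intros)
  moreover have "(\<lambda>n. zeta_aux p n s) sums (?F s / (s - 1))" if s: "Re s > 1" for s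
  proof -
    have nz: "s \<noteq> 0" "s \<noteq> 1" using s by auto
    have "(\<lambda>n. zeta_aux p n s) sums (of_real c * (1 / (s - 1)) + s * (F (s + 1) / (s + 1 - 1)))"
      unfolding split using s by (intro sums_add sums_mult zeta_aux_const_sums F(2)) auto
    then show ?thesis using nz by (simp add: field_simps)
  qed
  ultimately show ?case by blast
qed

lemma zeta_aux_continuation:
  assumes "continuous_on {0..1} p"
  shows "\<exists>F. F holomorphic_on UNIV \<and>
           (\<forall>s. Re s > 1 \<longrightarrow> (\<lambda>n. zeta_aux p n s) sums (F s / (s - 1)))"
proof -
  let ?H = "\<lambda>N. {s. Re s > 1 - real N}"
  obtain F where F: "\<And>N. F N holomorphic_on ?H N"
      "\<And>N s. Re s > 1 \<Longrightarrow> (\<lambda>n. zeta_aux p n s) sums (F N s / (s - 1))"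
    using zeta_aux_continuation_halfplane[OF assms] by metis
  have agree: "F M s = F N s" if "M \<le> N" "s \<in> ?H M" for M N s
  proof (rule analytic_continuation_open[of "{s. Re s > 1}" "?H M" "F M" "F N" s])
    show "F M z = F N z" if "z \<in> {s. Re s > 1}" for z
    proof -
      have "F M z / (z - 1) = F N z / (z - 1)"
        using F(2)[of z M] F(2)[of z N] that sums_unique2 by blast
      moreover have "z \<noteq> 1" using that by auto
      ultimately show ?thesis by simp
    qed
    show "{s::complex. Re s > 1} \<noteq> {}" by (auto intro!: exI[of _ 2])
    show "F N holomorphic_on ?H M"
      using that(1) by (intro holomorphic_on_subset[OF F(1)[of N]]) auto
  qed (use that F(1) in \<open>auto simp: open_halfspace_Re_gt convex_halfspace_Re_gt intro: convex_connected\<close>)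
  have agree': "F M s = F N s" if "s \<in> ?H M" "s \<in> ?H N" for M N s
  proof (cases "M \<le> N")
    case True
    then show ?thesis by (rule agree[OF _ that(1)])
  next
    case False
    then show ?thesis using agree[OF _ that(2), of M] by simp
  qed
  have mem: "s \<in> ?H (nat \<lceil>2 - Re s\<rceil>)" for s
    using of_nat_ceiling[of "2 - Re s"] by simp
  define G where "G = (\<lambda>s. F (nat \<lceil>2 - Re s\<rceil>) s)"
  have G: "G s = F N s" if "s \<in> ?H N" for N s
    unfolding G_def by (rule agree'[OF mem that])
  have "G holomorphic_on (\<Union>N. ?H N)"
  proof (rule holomorphic_on_UN_open)
    show "G holomorphic_on ?H N" for N
      using F(1)[of N] G by (subst holomorphic_cong[OF refl, of _ _ "F N"]) auto
  qed (rule open_halfspace_Re_gt)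
  moreover have "(\<Union>N. ?H N) = UNIV"
    using mem by blast
  moreover have "(\<lambda>n. zeta_aux p n s) sums (G s / (s - 1))" if "Re s > 1" for s
    using F(2)[of s 0] G[of s 0] that by simp
  ultimately show ?thesis by auto
qed

lemma is_riemann_zeta_exists: "\<exists>Z. is_riemann_zeta Z"
proof -
  let ?Q = "\<lambda>t::real. t - 1"
  obtain G where G: "G holomorphic_on UNIV"
      "\<And>s. Re s > 1 \<Longrightarrow> (\<lambda>n. zeta_aux ?Q n s) sums (G s / (s - 1))"
    using zeta_aux_continuation[of ?Q, OF continuous_on_diff[OF continuous_on_id continuous_on_const]]
    by blast
  define Z where "Z = (\<lambda>s. 1 / (s - 1) - G (s + 1))"
  have term_eq: "1 / of_nat (Suc n) powr s
      = zeta_aux (\<lambda>_. 1) n s - s * zeta_aux ?Q n (s + 1)" for n and s :: complex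
  proof -
    have "zeta_aux (\<lambda>_. 1) n s = of_nat (n + 1) powr (- s) + s * zeta_aux ?Q n (s + 1)"
      by (subst zeta_aux_by_parts[of "\<lambda>_. 1" ?Q n s])
        (auto intro!: continuous_intros derivative_eq_intros)
    then show ?thesis by (simp add: powr_minus divide_inverse)
  qed
  have "(\<lambda>s. G (s + 1)) holomorphic_on - {1}"
    by (rule holomorphic_on_compose_gen[OF _ G(1), unfolded o_def]) (auto intro!: holomorphic_intros)
  then have "Z holomorphic_on - {1}"
    unfolding Z_def by (intro holomorphic_intros) auto
  moreover have "(\<lambda>n. 1 / of_nat (Suc n) powr s) sums Z s" if s: "Re s > 1" for s
  proof -
    have "s \<noteq> 0" using s by auto
    have "(\<lambda>n. zeta_aux (\<lambda>_. 1) n s - s * zeta_aux ?Q n (s + 1)) sums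
        (1 / (s - 1) - s * (G (s + 1) / (s + 1 - 1)))"
      using s by (intro sums_diff sums_mult zeta_aux_const_sums G(2)) auto
    then show ?thesis using \<open>s \<noteq> 0\<close> by (simp add: term_eq Z_def del: of_nat_Suc)
  qed
  ultimately show ?thesis by (auto simp: is_riemann_zeta_def)
qed

lemma riemann_zeta: "is_riemann_zeta riemann_zeta"
  unfolding riemann_zeta_def by (rule someI_ex[OF is_riemann_zeta_exists])

lemma riemann_zeta_unique: "is_riemann_zeta Z \<Longrightarrow> s \<noteq> 1 \<Longrightarrow> Z s = riemann_zeta s"
  by (rule is_riemann_zeta_unique[OF _ riemann_zeta])


section \<open>Hardy spaces of the unit disk\<close>

text \<open>Functions on the disk are represented by total functions on the complex numbers; their
  values outside \<open>ball 0 1\<close> are irrelevant.\<close>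

definition hardy_mean :: "real \<Rightarrow> (complex \<Rightarrow> complex) \<Rightarrow> real \<Rightarrow> real" where
  "hardy_mean p f r = integral {0..2 * pi} (\<lambda>t. cmod (f (of_real r * cis t)) powr p) / (2 * pi)"

text \<open>\<open>hardy_space p\<close> is the space \<open>H\<^sup>p\<close>, meaningful for \<open>0 < p < \<infinity>\<close>.\<close>

definition hardy_space :: "real \<Rightarrow> (complex \<Rightarrow> complex) set" where
  "hardy_space p = {f. f holomorphic_on ball 0 1 \<and> bdd_above (hardy_mean p f ` {0..<1})}"

definition hardy_norm :: "real \<Rightarrow> (complex \<Rightarrow> complex) \<Rightarrow> real" where
  "hardy_norm p f = (SUP r\<in>{0..<1}. hardy_mean p f r) powr (1 / p)"

definition hardy_space_infinity :: "(complex \<Rightarrow> complex) set" where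
  "hardy_space_infinity = {f. f holomorphic_on ball 0 1 \<and> bounded (f ` ball 0 1)}"

definition dense_in_H2 :: "(complex \<Rightarrow> complex) set \<Rightarrow> bool" where
  "dense_in_H2 A \<longleftrightarrow> A \<subseteq> hardy_space 2 \<and>
     (\<forall>f\<in>hardy_space 2. \<forall>e>0. \<exists>g\<in>A. hardy_norm 2 (\<lambda>z. f z - g z) < e)"


section \<open>Outer functions and the Smirnov class\<close>

definition outer :: "(complex \<Rightarrow> complex) \<Rightarrow> bool" where
  "outer h \<longleftrightarrow> (\<exists>c w. cmod c = 1 \<and> w \<in> borel_measurable borel \<and> (\<forall>t. w t > 0) \<and>
     set_integrable lborel {0..2 * pi} (\<lambda>t. ln (w t)) \<and>
     (\<forall>z\<in>ball 0 1. h z = c * exp (1 / (2 * pi) *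
        (LINT t:{0..2 * pi}|lborel. (cis t + z) / (cis t - z) * complex_of_real (ln (w t))))))"

definition smirnov :: "(complex \<Rightarrow> complex) set" where
  "smirnov = {f. \<exists>g h. g \<in> hardy_space_infinity \<and> h \<in> hardy_space_infinity \<and> outer h \<and>
     (\<forall>z\<in>ball 0 1. f z = g z / h z)}"

text \<open>Nonvanishing has to be required explicitly, because \<open>1 / 0 = 0\<close>.\<close>

definition smirnov_unit :: "(complex \<Rightarrow> complex) \<Rightarrow> bool" where
  "smirnov_unit f \<longleftrightarrow> f \<in> smirnov \<and> (\<forall>z\<in>ball 0 1. f z \<noteq> 0) \<and> (\<lambda>z. 1 / f z) \<in> smirnov"


section \<open>The functions \<open>h\<^sub>k\<close> and their span\<close>

text \<open>The principal branch \<open>Ln\<close> is the required holomorphic branch of the logarithm on the disk;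
  see \<open>h_fun_log_branch\<close>.\<close>

definition h_fun :: "nat \<Rightarrow> complex \<Rightarrow> complex" where
  "h_fun k z = 1 / (1 - z) * Ln ((\<Sum>j<k. z ^ j) / of_nat k)"

lemma h_fun_log_branch:
  assumes k: "k \<ge> 1"
  shows "(\<lambda>z. Ln ((\<Sum>j<k. z ^ j) / of_nat k)) holomorphic_on ball 0 1"
    and "z \<in> ball 0 1 \<Longrightarrow> exp (Ln ((\<Sum>j<k. z ^ j) / of_nat k)) = (\<Sum>j<k. z ^ j) / of_nat k"
    and "Ln ((\<Sum>j<k. 0 ^ j) / of_nat k) = - of_real (ln (real k))"
proof -
  have nonpos: "(\<Sum>j<k. z ^ j) / of_nat k \<notin> \<real>\<^sub>\<le>\<^sub>0" if z: "z \<in> ball 0 1" for z :: complex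
  proof
    assume "(\<Sum>j<k. z ^ j) / of_nat k \<in> \<real>\<^sub>\<le>\<^sub>0"
    then obtain x where x: "x \<le> 0" "(\<Sum>j<k. z ^ j) / of_nat k = complex_of_real x"
      by (auto elim!: nonpos_Reals_cases)
    have pos: "Re (1 - w) > 0" if "cmod w < 1" for w
      using complex_Re_le_cmod[of w] that by simp
    have "1 - z ^ k = (1 - z) * (\<Sum>j<k. z ^ j)"
      by (rule one_diff_power_eq)
    also have "(\<Sum>j<k. z ^ j) = of_real (real k * x)"
      using x(2) k by (simp add: field_simps)
    finally have "Re (1 - z ^ k) = Re (1 - z) * (real k * x)"
      by simp
    also have "\<dots> \<le> 0"
      using x(1) pos[of z] z by (intro mult_nonneg_nonpos) (auto simp: mult_nonneg_nonpos)
    finally show False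
      using pos[of "z ^ k"] z k by (simp add: norm_power power_less_one_iff)
  qed
  show "(\<lambda>z. Ln ((\<Sum>j<k. z ^ j) / of_nat k)) holomorphic_on ball 0 1"
    using nonpos k by (intro holomorphic_intros) auto
  show "exp (Ln ((\<Sum>j<k. z ^ j) / of_nat k)) = (\<Sum>j<k. z ^ j) / of_nat k" if "z \<in> ball 0 1"
    by (rule exp_Ln) (use nonpos[OF that] in force)
  have "(\<Sum>j<k. 0 ^ j) = (\<Sum>j<k. if j = 0 then 1 else (0::complex))"
    by (intro sum.cong) (auto simp: power_0_left)
  also have "\<dots> = 1" using k by simp
  finally have "(\<Sum>j<k. 0 ^ j) / of_nat k = complex_of_real (inverse (real k))"
    by (simp add: divide_inverse)
  moreover have "Ln (complex_of_real (inverse (real k))) = of_real (ln (inverse (real k)))"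
    using k by (intro Ln_of_real) simp
  ultimately show "Ln ((\<Sum>j<k. 0 ^ j) / of_nat k) = - of_real (ln (real k))"
    using k by (simp only: ln_inverse) simp
qed

definition h_span :: "(complex \<Rightarrow> complex) set" where
  "h_span = {(\<lambda>z. \<Sum>k\<in>K. c k * h_fun k z) | K c. finite K \<and> K \<subseteq> {2..}}"

end

theory Submission
  imports Defs "HOL-Real_Asymp.Real_Asymp"
begin

text \<open>
  A zero \<open>s\<close> of zeta with \<open>Re s > 0\<close> yields a linear functional that annihilates all the
  functions \<open>h_fun k\<close>. Up to a factor, it is the functional
  \<open>\<Sum>n. a n * (n powr (1 - s) - (n + 1) powr (1 - s))\<close> of the Taylor coefficients \<open>a n\<close>, whose
  value at \<open>h_fun k\<close> is \<open>(1 - k powr (1 - s)) * zeta s\<close>. The point of the proof is to write it, up to a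
  multiple of \<open>f 0\<close>, as an integral of \<open>(f x - f 0) / x\<close> over the radius \<open>{0<..<1}\<close> against a weight
  that behaves like \<open>(1 - x) powr (s - 1)\<close> near \<open>1\<close> (\<open>zeta_zero_functional\<close>). The identity behind
  this is the Mellin transform \<open>log_der_integral_zeta\<close> of the derivative of \<open>(1 - x) * h_fun k x\<close>,
  followed by an integration by parts.

  In this form the continuity of the functional needs no duality theory of Hardy spaces. Put
  \<open>B = 1 / \<phi>\<close>. If \<open>\<phi> * f\<close> is close to \<open>g\<close> in \<open>H\<^sup>2\<close>, then \<open>f\<close> differs from \<open>B * g\<close> by a product
  of \<open>B\<close> with a function that is small in \<open>H\<^sup>2\<close>. By the Fejer-Riesz inequality (\<open>fejer_riesz\<close>)
  functions in \<open>H\<^sup>2\<close> are square integrable over the radius, with control of the norm. Hence the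
  functional passes to the limit as soon as the weight times \<open>B\<close> is square integrable over the
  radius. Each of the three hypotheses on \<open>B\<close> gives this for its range of \<open>s\<close>. For bounded \<open>B\<close> the
  weight alone is square integrable. For \<open>H\<^sup>2\<close> the weight is bounded near \<open>1\<close>. For \<open>H\<^sup>p\<close> the function
  \<open>B powr (p / 2)\<close> is in \<open>H\<^sup>2\<close>, so that \<open>(cmod B) powr p\<close> is integrable over the radius, and
  Young's inequality leaves the power \<open>(1 - x) powr ((2 * Re s - 2) * p / (p - 2))\<close>, integrable near
  \<open>1\<close> for \<open>Re s > 1 / 2 + 1 / p\<close>.

  By density the functional then annihilates \<open>B z * z ^ Suc n\<close> for every \<open>n\<close>
  (\<open>zeta_zero_moments_vanish\<close>). These values are the moments of an integrable function on the
  unit interval, the weight times \<open>B\<close>. By the Weierstrass theorem this function is \<open>0\<close>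
  (\<open>vanishing_moments\<close>), but neither the weight nor \<open>B\<close> has a zero on the radius. So zeta has no
  zero in the range considered.\<close>

section \<open>Powers of the logarithm on the unit interval\<close>

text \<open>The kernel \<open>(- ln x) powr a\<close> is the density of the Mellin transform after the substitution
  \<open>x = exp (- u)\<close>.\<close>

definition log_kernel :: "complex \<Rightarrow> real \<Rightarrow> complex" where
  "log_kernel a x = of_real (- ln x) powr a"

lemma norm_log_kernel: "0 < x \<Longrightarrow> x < 1 \<Longrightarrow> cmod (log_kernel a x) = (- ln x) powr Re a"
  unfolding log_kernel_def by (rule norm_of_real_powr) simp

lemma continuous_on_log_kernel: "continuous_on {0<..<1} (log_kernel a)"
  unfolding log_kernel_def[abs_def]
  by (intro continuous_intros continuous_on_powr_complex) (auto simp: complex_nonpos_Reals_iff)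

lemma continuous_bounded_imp_absolutely_integrable:
  fixes f :: "real \<Rightarrow> 'a::euclidean_space"
  assumes "continuous_on {0<..<1} f" "g integrable_on {0<..<1}"
    and "\<And>x. 0 < x \<Longrightarrow> x < 1 \<Longrightarrow> norm (f x) \<le> g x"
  shows "f absolutely_integrable_on {0<..<1}"
  by (rule measurable_bounded_by_integrable_imp_absolutely_integrable
      [OF continuous_imp_measurable_on_sets_lebesgue[OF assms(1)] _ assms(2)])
    (use assms(3) in auto)

text \<open>Under \<open>u = - (n + 1) ln x\<close> this is Euler's integral for \<open>Gamma s\<close>. Multiplying an integrand by
  a power series in \<open>x\<close> therefore produces a Dirichlet series with the same coefficients.\<close>

lemma log_kernel_moment:
  assumes s: "Re s > 0"
  shows "(\<lambda>x. log_kernel (s - 1) x * of_real x ^ n) absolutely_integrable_on {0<..<1}"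
    and "((\<lambda>x. log_kernel (s - 1) x * of_real x ^ n) has_integral
            Gamma s * of_nat (Suc n) powr (- s)) {0<..<1}"
proof -
  let ?f = "\<lambda>t. complex_of_real t powr (s - 1) / of_real (exp t)"
  let ?g = "\<lambda>x. - (real (Suc n) * ln x)"
  let ?h = "\<lambda>x. - (real (Suc n) / x)"
  let ?F = "\<lambda>x. \<bar>?h x\<bar> *\<^sub>R ?f (?g x)"
  have der: "(?g has_field_derivative ?h x) (at x within {0<..<1})" if "x \<in> {0<..<1}" for x
    using that by (auto intro!: derivative_eq_intros simp del: of_nat_Suc)
  have inj: "inj_on ?g {0<..<1}"
    by (rule inj_onI) (auto simp del: of_nat_Suc)
  have img: "?g ` {0<..<1} = {0<..}"
  proof (rule set_eqI)
    fix y :: real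
    show "y \<in> ?g ` {0<..<1} \<longleftrightarrow> y \<in> {0<..}"
    proof
      assume "y \<in> ?g ` {0<..<1}"
      then show "y \<in> {0<..}" by (auto simp: mult_pos_neg simp del: of_nat_Suc)
    next
      assume y: "y \<in> {0<..}"
      show "y \<in> ?g ` {0<..<1}"
        by (rule image_eqI[of _ _ "exp (- (y / real (Suc n)))"]) (use y in \<open>auto simp del: of_nat_Suc\<close>)
    qed
  qed
  have "?f absolutely_integrable_on ?g ` {0<..<1}" "integral (?g ` {0<..<1}) ?f = Gamma s"
    using absolutely_integrable_Gamma_integral'[OF s] integral_unique[OF Gamma_integral_complex'[OF s]]
    by (simp_all only: img)
  then have F: "?F absolutely_integrable_on {0<..<1}" and iF: "integral {0<..<1} ?F = Gamma s"
    using has_absolute_integral_change_of_variables_real[OF _ der inj, of ?f "Gamma s"] by auto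
  have eq: "?F x = of_nat (Suc n) powr s * (log_kernel (s - 1) x * of_real x ^ n)"
    if x: "x \<in> {0<..<1}" for x
  proof -
    have "exp (?g x) = inverse (x ^ Suc n)"
      using x exp_of_nat_mult[of "Suc n" "ln x"] by (simp add: exp_minus)
    moreover have "complex_of_real (?g x) powr (s - 1)
        = of_nat (Suc n) powr (s - 1) * log_kernel (s - 1) x"
      using x powr_times_real[of "of_nat (Suc n)" "of_real (- ln x)" "s - 1"]
      by (simp add: log_kernel_def del: of_nat_Suc)
    moreover have "\<bar>?h x\<bar> = real (Suc n) / x" using x by (simp del: of_nat_Suc)
    ultimately have "?F x = (of_nat (Suc n) / of_real x) *
        (of_nat (Suc n) powr (s - 1) * log_kernel (s - 1) x / inverse (of_real x ^ Suc n))"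
      by (simp add: scaleR_conv_of_real del: of_nat_Suc power_Suc)
    also have "\<dots> = (of_nat (Suc n) * of_nat (Suc n) powr (s - 1)) * (log_kernel (s - 1) x * of_real x ^ n)"
      using x by (simp add: field_simps del: of_nat_Suc)
    also have "of_nat (Suc n) * of_nat (Suc n) powr (s - 1) = (of_nat (Suc n) powr s :: complex)"
      by (simp add: powr_diff del: of_nat_Suc)
    finally show ?thesis .
  qed
  have nz: "of_nat (Suc n) powr s \<noteq> (0::complex)" by (simp del: of_nat_Suc)
  have G: "(\<lambda>x. of_nat (Suc n) powr s * (log_kernel (s - 1) x * of_real x ^ n))
      absolutely_integrable_on {0<..<1}"
    using absolutely_integrable_spike[OF F, of "{}"] eq by simp
  have "(\<lambda>x. inverse (of_nat (Suc n) powr s) *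
      (of_nat (Suc n) powr s * (log_kernel (s - 1) x * of_real x ^ n))) absolutely_integrable_on {0<..<1}"
    by (intro set_integrable_mult_right G)
  then show A: "(\<lambda>x. log_kernel (s - 1) x * of_real x ^ n) absolutely_integrable_on {0<..<1}"
    using nz by (simp add: mult.assoc[symmetric] del: of_nat_Suc)
  have "integral {0<..<1} (\<lambda>x. of_nat (Suc n) powr s * (log_kernel (s - 1) x * of_real x ^ n)) = Gamma s"
    using iF integral_cong[of "{0<..<1}" ?F, OF eq] by simp
  then have "of_nat (Suc n) powr s * integral {0<..<1} (\<lambda>x. log_kernel (s - 1) x * of_real x ^ n) = Gamma s"
    by simp
  then have "integral {0<..<1} (\<lambda>x. log_kernel (s - 1) x * of_real x ^ n)
      = Gamma s * of_nat (Suc n) powr (- s)"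
    using nz by (simp add: powr_minus field_simps del: of_nat_Suc)
  then show "((\<lambda>x. log_kernel (s - 1) x * of_real x ^ n) has_integral
            Gamma s * of_nat (Suc n) powr (- s)) {0<..<1}"
    using A by (metis has_integral_integral set_lebesgue_integral_eq_integral(1))
qed

lemma log_powr_integrable:
  assumes "a > -1"
  shows "(\<lambda>x. (- ln x) powr a) integrable_on {0<..<1::real}"
proof -
  have "(\<lambda>x. log_kernel (of_real (a + 1) - 1) x * of_real x ^ 0) absolutely_integrable_on {0<..<1}"
    by (rule log_kernel_moment) (use assms in auto)
  then have "(\<lambda>x. cmod (log_kernel (of_real a) x)) integrable_on {0<..<1}"
    by (simp add: absolutely_integrable_on_def)
  then show ?thesis
    by (rule integrable_eq) (auto simp: norm_log_kernel)
qed

section \<open>Zeta as a Mellin transform on the right half-plane\<close>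

text \<open>Writing \<open>Q x = (\<Sum>j<k. x ^ j)\<close>, differentiation of \<open>(1 - x) * Q x = 1 - x ^ k\<close> shows that
  \<open>log_der k\<close> below is the logarithmic derivative \<open>Q' / Q\<close>, the derivative of \<open>(1 - x) * h_fun k x\<close>. Its
  power series has the coefficients \<open>1, \<dots>, 1, 1 - k\<close>, repeated with period \<open>k\<close>; \<open>block_poly k\<close>
  collects one period.\<close>

definition block_poly :: "nat \<Rightarrow> real \<Rightarrow> real" where
  "block_poly k x = (\<Sum>j<k. x ^ j) - real k * x ^ (k - 1)"

definition log_der :: "nat \<Rightarrow> real \<Rightarrow> real" where
  "log_der k x = block_poly k x / (1 - x ^ k)"

lemma block_poly_bounds:
  assumes "0 < x" "x < 1" "k \<ge> 1"
  shows "0 \<le> block_poly k x" "block_poly k x \<le> real k * (1 - x ^ k)"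
proof -
  have eq: "block_poly k x = (\<Sum>j<k. x ^ j - x ^ (k - 1))"
    by (simp add: block_poly_def sum_subtractf)
  show "0 \<le> block_poly k x"
    unfolding eq using assms by (intro sum_nonneg) (auto intro!: power_decreasing)
  have "x ^ j - x ^ (k - 1) \<le> 1 - x ^ k" if "j < k" for j
  proof -
    have "x ^ j - x ^ (k - 1) = x ^ j * (1 - x ^ (k - 1 - j))"
      using that by (simp add: algebra_simps flip: power_add)
    also have "\<dots> \<le> 1 * (1 - x ^ k)"
      using assms that by (intro mult_mono diff_mono power_decreasing) (auto simp: power_le_one)
    finally show ?thesis by simp
  qed
  then have "block_poly k x \<le> (\<Sum>j<k. 1 - x ^ k)"
    unfolding eq by (intro sum_mono) auto
  then show "block_poly k x \<le> real k * (1 - x ^ k)" by simp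
qed

lemma log_der_bounds:
  assumes "0 < x" "x < 1" "k \<ge> 1"
  shows "0 \<le> log_der k x" "log_der k x \<le> real k"
proof -
  have "x ^ k < 1" using assms by (simp add: power_less_one_iff)
  then show "0 \<le> log_der k x" "log_der k x \<le> real k"
    using block_poly_bounds[OF assms] by (auto simp: log_der_def divide_simps)
qed

lemma continuous_on_block_poly: "continuous_on A (block_poly k)"
  unfolding block_poly_def[abs_def] by (intro continuous_intros)

lemma continuous_on_log_der: "k \<ge> 1 \<Longrightarrow> continuous_on {0<..<1} (log_der k)"
  unfolding log_der_def[abs_def]
proof (intro continuous_intros continuous_on_block_poly ballI)
  fix x :: real assume "k \<ge> 1" "x \<in> {0<..<1}"
  then have "x ^ k < 1" by (simp add: power_less_one_iff)
  then show "1 - x ^ k \<noteq> 0" by simp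
qed

lemma log_der_sums:
  assumes "0 < x" "x < 1" "k \<ge> 1"
  shows "(\<lambda>m. x ^ (k * m) * block_poly k x) sums log_der k x"
proof -
  have "norm (x ^ k) < 1" using assms by (simp add: power_less_one_iff)
  from sums_mult2[OF geometric_sums[OF this], of "block_poly k x"]
  show ?thesis by (simp add: log_der_def power_mult)
qed

text \<open>Summing by whole periods is what makes this work for every weight: one period is nonnegative on
  the unit interval, so the partial sums are dominated by \<open>log_der k\<close>, which is bounded by \<open>k\<close>. For
  the kernel of exponent \<open>s - 1\<close> with \<open>Re s \<le> 1\<close>, the terms of the power series taken one at a time give a
  series that does not converge absolutely.\<close>

lemma log_der_weighted_integral_sums:
  fixes w :: "real \<Rightarrow> 'a::euclidean_space"
  assumes k: "k \<ge> 1" and w: "continuous_on {0<..<1} w" "w absolutely_integrable_on {0<..<1}"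
  shows "(\<lambda>m. integral {0<..<1} (\<lambda>x. (x ^ (k * m) * block_poly k x) *\<^sub>R w x)) sums
           integral {0<..<1} (\<lambda>x. log_der k x *\<^sub>R w x)"
    and "(\<lambda>x. (x ^ (k * m) * block_poly k x) *\<^sub>R w x) absolutely_integrable_on {0<..<1}"
    and "(\<lambda>x. log_der k x *\<^sub>R w x) absolutely_integrable_on {0<..<1}"
proof -
  let ?t = "\<lambda>m x. x ^ (k * m) * block_poly k x"
  let ?S = "\<lambda>N x. \<Sum>m<N. ?t m x"
  have t0: "0 \<le> ?t m x" if "0 < x" "x < 1" for m x
    using block_poly_bounds(1)[OF that k] that by simp
  have S: "0 \<le> ?S N x" "?S N x \<le> real k" if x: "0 < x" "x < 1" for N x
  proof -
    show "0 \<le> ?S N x" using t0[OF x] by (intro sum_nonneg)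
    have "?S N x \<le> log_der k x"
      using log_der_sums[OF x k] t0[OF x] sum_le_suminf[of "\<lambda>m. ?t m x" "{..<N}"]
      by (simp add: sums_iff)
    then show "?S N x \<le> real k" using log_der_bounds[OF x k] by simp
  qed
  have bound: "(\<lambda>x. real k * norm (w x)) integrable_on {0<..<1}"
    using w(2) by (intro integrable_on_mult_right) (simp add: absolutely_integrable_on_def)
  have tm: "(\<lambda>x. ?t m x *\<^sub>R w x) absolutely_integrable_on {0<..<1}" for m
  proof (rule continuous_bounded_imp_absolutely_integrable[OF _ bound])
    show "continuous_on {0<..<1} (\<lambda>x. ?t m x *\<^sub>R w x)"
      by (intro continuous_intros continuous_on_block_poly w)
    fix x :: real assume x: "0 < x" "x < 1"
    have "?t m x \<le> ?S (Suc m) x"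
      using t0[OF x] by (intro member_le_sum) auto
    then have "?t m x \<le> real k" using S(2)[OF x, of "Suc m"] by linarith
    then show "norm (?t m x *\<^sub>R w x) \<le> real k * norm (w x)"
      using t0[OF x, of m] by (simp only: norm_scaleR) (intro mult_right_mono, auto)
  qed
  then show "(\<lambda>x. ?t m x *\<^sub>R w x) absolutely_integrable_on {0<..<1}" .
  show "(\<lambda>x. log_der k x *\<^sub>R w x) absolutely_integrable_on {0<..<1}"
  proof (rule continuous_bounded_imp_absolutely_integrable[OF _ bound])
    show "continuous_on {0<..<1} (\<lambda>x. log_der k x *\<^sub>R w x)"
      by (intro continuous_intros continuous_on_log_der k w)
    show "norm (log_der k x *\<^sub>R w x) \<le> real k * norm (w x)" if "0 < x" "x < 1" for x
      using log_der_bounds[OF that k] by (auto intro!: mult_right_mono)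
  qed
  have ti: "(\<lambda>x. ?t m x *\<^sub>R w x) integrable_on {0<..<1}" for m
    using tm set_lebesgue_integral_eq_integral(1) by blast
  have "(\<lambda>N. integral {0<..<1} (\<lambda>x. ?S N x *\<^sub>R w x)) \<longlonglongrightarrow> integral {0<..<1} (\<lambda>x. log_der k x *\<^sub>R w x)"
  proof (rule dominated_convergence(2)[OF _ bound])
    show "(\<lambda>x. ?S N x *\<^sub>R w x) integrable_on {0<..<1}" for N
      unfolding scaleR_sum_left by (intro integrable_sum ti) auto
    fix x :: real assume "x \<in> {0<..<1}"
    then have x: "0 < x" "x < 1" by auto
    show "norm (?S N x *\<^sub>R w x) \<le> real k * norm (w x)" for N
      using S[OF x, of N] by (simp only: norm_scaleR) (intro mult_right_mono, auto)
    show "(\<lambda>N. ?S N x *\<^sub>R w x) \<longlonglongrightarrow> log_der k x *\<^sub>R w x"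
      using log_der_sums[OF x k] unfolding sums_def by (intro tendsto_intros)
  qed
  moreover have "integral {0<..<1} (\<lambda>x. ?S N x *\<^sub>R w x) = (\<Sum>m<N. integral {0<..<1} (\<lambda>x. ?t m x *\<^sub>R w x))" for N
    unfolding scaleR_sum_left by (intro integral_sum ti) auto
  ultimately show "(\<lambda>m. integral {0<..<1} (\<lambda>x. ?t m x *\<^sub>R w x)) sums
           integral {0<..<1} (\<lambda>x. log_der k x *\<^sub>R w x)"
    by (simp add: sums_def)
qed

lemma log_kernel_absolutely_integrable:
  "Re s > 0 \<Longrightarrow> log_kernel (s - 1) absolutely_integrable_on {0<..<1}"
  using log_kernel_moment(1)[of s 0] by simp

lemma log_kernel_block_integral:
  assumes s: "Re s > 0" and k: "k \<ge> 1"
  shows "integral {0<..<1} (\<lambda>x. (x ^ (k * m) * block_poly k x) *\<^sub>R log_kernel (s - 1) x)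
    = Gamma s * ((\<Sum>j<k. of_nat (Suc (m * k + j)) powr (- s)) - of_nat k * of_nat (m * k + k) powr (- s))"
proof (rule integral_unique)
  have "((\<lambda>x. (\<Sum>j<k. log_kernel (s - 1) x * of_real x ^ (m * k + j))
        - of_nat k * (log_kernel (s - 1) x * of_real x ^ (m * k + (k - 1)))) has_integral
      ((\<Sum>j<k. Gamma s * of_nat (Suc (m * k + j)) powr (- s))
        - of_nat k * (Gamma s * of_nat (Suc (m * k + (k - 1))) powr (- s)))) {0<..<1}"
    by (intro has_integral_diff has_integral_sum has_integral_mult_right log_kernel_moment(2) s) auto
  moreover have "Suc (m * k + (k - 1)) = m * k + k" using k by simp
  moreover have "(\<Sum>j<k. log_kernel (s - 1) x * of_real x ^ (m * k + j))
        - of_nat k * (log_kernel (s - 1) x * of_real x ^ (m * k + (k - 1)))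
      = (x ^ (k * m) * block_poly k x) *\<^sub>R log_kernel (s - 1) x" for x
    by (simp add: block_poly_def scaleR_conv_of_real power_add right_diff_distrib sum_distrib_left
        sum_distrib_right mult_ac)
  ultimately show "((\<lambda>x. (x ^ (k * m) * block_poly k x) *\<^sub>R log_kernel (s - 1) x) has_integral
      Gamma s * ((\<Sum>j<k. of_nat (Suc (m * k + j)) powr (- s)) - of_nat k * of_nat (m * k + k) powr (- s)))
      {0<..<1}"
    by (simp add: algebra_simps sum_distrib_left)
qed

text \<open>The coefficients \<open>1 - k [k dvd n]\<close> have the Dirichlet series
  \<open>(1 - k powr (1 - s)) * zeta s\<close> where it converges absolutely.\<close>

lemma log_der_integral_half_plane_1:
  assumes s: "Re s > 1" and k: "k \<ge> 1"
  shows "integral {0<..<1} (\<lambda>x. log_der k x *\<^sub>R log_kernel (s - 1) x)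
    = Gamma s * (riemann_zeta s * (1 - of_nat k powr (1 - s)))"
proof -
  have s0: "Re s > 0" using s by simp
  have z: "(\<lambda>n. 1 / of_nat (Suc n) powr s) sums riemann_zeta s"
    using riemann_zeta s unfolding is_riemann_zeta_def by blast
  have pm: "1 / w powr s = w powr (- s)" for w :: complex
    by (simp add: powr_minus divide_inverse)
  have "(\<lambda>m. sum (\<lambda>n. 1 / of_nat (Suc n) powr s) {m * k..<m * k + k}) sums riemann_zeta s"
    using sums_group[OF z] k by simp
  then have g: "(\<lambda>m. \<Sum>j<k. of_nat (Suc (m * k + j)) powr (- s)) sums riemann_zeta s"
    using sum.shift_bounds_nat_ivl[of "\<lambda>n. of_nat (Suc n) powr (- s)" 0 "m * k" k for m]
    by (simp add: pm lessThan_atLeast0 add.commute del: of_nat_Suc)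
  have "of_nat k * of_nat (m * k + k) powr (- s) = of_nat k powr (1 - s) * (1 / of_nat (Suc m) powr s :: complex)" for m
  proof -
    have "of_nat (m * k + k) powr (- s) = (of_nat (Suc m) powr (- s) * of_nat k powr (- s) :: complex)"
      using powr_times_real[of "of_nat (Suc m)" "of_nat k" "- s"] by (simp add: algebra_simps)
    moreover have "of_nat k * of_nat k powr (- s) = (of_nat k powr (1 - s) :: complex)"
      using k by (simp add: powr_diff powr_minus divide_inverse)
    ultimately show ?thesis unfolding pm by (simp del: of_nat_Suc)
  qed
  then have h: "(\<lambda>m. of_nat k * of_nat (m * k + k) powr (- s)) sums (of_nat k powr (1 - s) * riemann_zeta s)"
    using sums_mult[OF z, of "of_nat k powr (1 - s)"] by simp
  have "(\<lambda>m. Gamma s * ((\<Sum>j<k. of_nat (Suc (m * k + j)) powr (- s)) - of_nat k * of_nat (m * k + k) powr (- s)))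
      sums (Gamma s * (riemann_zeta s - of_nat k powr (1 - s) * riemann_zeta s))"
    by (intro sums_mult sums_diff g h)
  with log_der_weighted_integral_sums(1)[OF k continuous_on_log_kernel log_kernel_absolutely_integrable[OF s0]]
  show ?thesis
    unfolding log_kernel_block_integral[OF s0 k] using sums_unique2 by (fastforce simp: algebra_simps)
qed

text \<open>The period sums are holomorphic in \<open>s\<close>, being finite combinations of \<open>Gamma s * n powr (- s)\<close>.
  They converge locally uniformly by the M-test: for \<open>a \<le> Re s \<le> b\<close> the kernel is at most
  the sum of the kernels for \<open>a\<close> and \<open>b\<close>, and for these two real exponents the period integrals are
  summable.\<close>

lemma log_der_integral_holomorphic:
  assumes k: "k \<ge> 1"
  shows "(\<lambda>s. integral {0<..<1} (\<lambda>x. log_der k x *\<^sub>R log_kernel (s - 1) x)) holomorphic_on {s. Re s > 0}"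
proof -
  let ?H = "{s::complex. Re s > 0}"
  define T where "T = (\<lambda>m s. Gamma s * ((\<Sum>j<k. of_nat (Suc (m * k + j)) powr (- s))
    - of_nat k * of_nat (m * k + k) powr (- s)) :: complex)"
  have T: "integral {0<..<1} (\<lambda>x. (x ^ (k * m) * block_poly k x) *\<^sub>R log_kernel (s - 1) x) = T m s"
    if "Re s > 0" for m s
    unfolding T_def by (rule log_kernel_block_integral[OF that k])
  have H: "open ?H" by (rule open_halfspace_Re_gt)
  have "T m holomorphic_on ?H" for m
  proof -
    have "Re s > 0 \<Longrightarrow> s \<notin> \<int>\<^sub>\<le>\<^sub>0" for s by (auto elim!: nonpos_Ints_cases)
    then show ?thesis
      unfolding T_def by (intro holomorphic_intros) auto
  qed
  then have fd: "T m field_differentiable (at s)" if "s \<in> ?H" for m s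
    using that H holomorphic_on_imp_differentiable_at by blast
  have bd: "\<exists>d h. 0 < d \<and> summable h \<and> range h \<subseteq> \<real>\<^sub>\<ge>\<^sub>0 \<and>
      (\<forall>\<^sub>F m in sequentially. \<forall>y\<in>ball s d \<inter> ?H. cmod (T m y) \<le> cmod (h m))"
    if s: "s \<in> ?H" for s
  proof -
    define a where "a = Re s / 2"
    define b where "b = 2 * Re s"
    have a: "a > 0" using s by (simp add: a_def)
    define w where "w = (\<lambda>x::real. (- ln x) powr (a - 1) + (- ln x) powr (b - 1))"
    have w: "continuous_on {0<..<1} w"
      unfolding w_def by (intro continuous_intros) (auto simp: )
    have w_int: "w integrable_on {0<..<1}"
      unfolding w_def using s by (intro integrable_add log_powr_integrable) (auto simp: a_def b_def)
    then have wa: "w absolutely_integrable_on {0<..<1}"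
      by (rule nonnegative_absolutely_integrable_1) (auto simp: w_def)
    note ws = log_der_weighted_integral_sums[OF k w wa]
    define h where "h = (\<lambda>m. integral {0<..<1} (\<lambda>x. (x ^ (k * m) * block_poly k x) *\<^sub>R w x))"
    have bound: "cmod (T m y) \<le> h m" if y: "y \<in> ball s a \<inter> ?H" for m y
    proof -
      have "\<bar>Re (s - y)\<bar> < a" using y abs_Re_le_cmod[of "s - y"] by (auto simp: dist_norm)
      then have ab: "a \<le> Re y" "Re y \<le> b" by (auto simp: a_def b_def abs_if field_simps split: if_splits)
      have y0: "Re y > 0" using y by simp
      show ?thesis
        unfolding h_def T[OF y0, symmetric]
      proof (rule integral_norm_bound_integral)
        show "(\<lambda>x. (x ^ (k * m) * block_poly k x) *\<^sub>R log_kernel (y - 1) x) integrable_on {0<..<1}"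
          using log_der_weighted_integral_sums(2)[OF k continuous_on_log_kernel
              log_kernel_absolutely_integrable[OF y0]] set_lebesgue_integral_eq_integral(1) by blast
        show "(\<lambda>x. (x ^ (k * m) * block_poly k x) *\<^sub>R w x) integrable_on {0<..<1}"
          using ws(2) set_lebesgue_integral_eq_integral(1) by blast
        fix x :: real assume "x \<in> {0<..<1}"
        then have x: "0 < x" "x < 1" by auto
        have "(- ln x) powr (Re y - 1) \<le> w x"
        proof (cases "- ln x \<le> 1")
          case True
          then have "(- ln x) powr (Re y - 1) \<le> (- ln x) powr (a - 1)"
            using x ab by (intro powr_mono') auto
          then show ?thesis by (simp add: w_def add_increasing2)
        next
          case False
          then have "(- ln x) powr (Re y - 1) \<le> (- ln x) powr (b - 1)"
            using x ab by (intro powr_mono) auto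
          then show ?thesis by (simp add: w_def add_increasing)
        qed
        then show "norm ((x ^ (k * m) * block_poly k x) *\<^sub>R log_kernel (y - 1) x)
            \<le> (x ^ (k * m) * block_poly k x) *\<^sub>R w x"
          using block_poly_bounds(1)[OF x k] x
          by (simp add: norm_log_kernel abs_mult mult_left_mono)
      qed
    qed
    have h0: "h m \<ge> 0" for m
    proof -
      have "cmod (T m s) \<le> h m" using bound[of s m] s a by simp
      then show ?thesis using norm_ge_zero[of "T m s"] by linarith
    qed
    have "summable h" using ws(1) by (auto simp: h_def summable_def)
    then have "summable (\<lambda>m. complex_of_real (h m))" by (rule summable_of_real)
    then show ?thesis
      using a bound h0 by (intro exI[of _ a] exI[of _ "\<lambda>m. complex_of_real (h m)"]) auto
  qed
  obtain g where g: "\<forall>s\<in>?H. (\<lambda>m. T m s) sums g s \<and> g field_differentiable (at s)"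
    by (rule series_differentiable_comparison_complex[OF H fd bd]) auto
  have "integral {0<..<1} (\<lambda>x. log_der k x *\<^sub>R log_kernel (s - 1) x) = g s" if "s \<in> ?H" for s
  proof -
    have s: "Re s > 0" using that by simp
    have "(\<lambda>m. T m s) sums integral {0<..<1} (\<lambda>x. log_der k x *\<^sub>R log_kernel (s - 1) x)"
      using log_der_weighted_integral_sums(1)[OF k continuous_on_log_kernel
          log_kernel_absolutely_integrable[OF s]] by (simp add: T[OF s])
    then show ?thesis using g that sums_unique2 by blast
  qed
  moreover have "g holomorphic_on ?H"
    using g by (auto simp: holomorphic_on_def intro: field_differentiable_at_within)
  ultimately show ?thesis by (subst holomorphic_cong[OF refl, of _ _ g]) auto
qed

text \<open>Both sides are holomorphic on the right half-plane without \<open>1\<close>, so they agree there by analytic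
  continuation.\<close>

theorem log_der_integral_zeta:
  assumes s: "Re s > 0" "s \<noteq> 1" and k: "k \<ge> 1"
  shows "integral {0<..<1} (\<lambda>x. log_der k x *\<^sub>R log_kernel (s - 1) x)
    = Gamma s * (riemann_zeta s * (1 - of_nat k powr (1 - s)))"
proof (rule analytic_continuation_open[of "{s. Re s > 1}" "{s. Re s > 0} - {1}"
      "\<lambda>s. integral {0<..<1} (\<lambda>x. log_der k x *\<^sub>R log_kernel (s - 1) x)"
      "\<lambda>s. Gamma s * (riemann_zeta s * (1 - of_nat k powr (1 - s)))"])
  have "Re s > 0 \<Longrightarrow> s \<notin> \<int>\<^sub>\<le>\<^sub>0" for s by (auto elim!: nonpos_Ints_cases)
  moreover have "riemann_zeta holomorphic_on ({s. Re s > 0} - {1})"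
    using riemann_zeta unfolding is_riemann_zeta_def by (auto intro: holomorphic_on_subset)
  ultimately show "(\<lambda>s. Gamma s * (riemann_zeta s * (1 - of_nat k powr (1 - s)))) holomorphic_on ({s. Re s > 0} - {1})"
    using k by (intro holomorphic_intros) auto
  show "(\<lambda>s. integral {0<..<1} (\<lambda>x. log_der k x *\<^sub>R log_kernel (s - 1) x)) holomorphic_on ({s. Re s > 0} - {1})"
    using log_der_integral_holomorphic[OF k] by (rule holomorphic_on_subset) auto
  show "connected ({s::complex. Re s > 0} - {1})"
    by (intro connected_open_delete open_halfspace_Re_gt convex_connected convex_halfspace_Re_gt) auto
qed (use s k log_der_integral_half_plane_1 in
   \<open>auto simp: open_halfspace_Re_gt intro!: exI[of _ 2]\<close>)

section \<open>The functional attached to a zero of zeta\<close>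

text \<open>For real \<open>x\<close> in \<open>{0..<1}\<close> this is \<open>(1 - x) * (h_fun k x - h_fun k 0)\<close>. The subtraction makes
  the function vanish at both ends of the unit interval, which leaves no boundary terms when
  integrating by parts.\<close>

definition h_log :: "nat \<Rightarrow> real \<Rightarrow> real" where
  "h_log k x = ln ((\<Sum>j<k. x ^ j) / real k) + ln (real k) * (1 - x)"

lemma geom_sum_ge_1: "k \<ge> 1 \<Longrightarrow> 0 \<le> x \<Longrightarrow> 1 \<le> (\<Sum>j<k. x ^ j :: real)"
  using member_le_sum[of 0 "{..<k}" "\<lambda>j. x ^ j"] by simp

lemma h_log_ends:
  assumes "k \<ge> 1" shows "h_log k 0 = 0" "h_log k 1 = 0"
proof -
  have "(\<Sum>j<k. 0 ^ j) = (1::real)"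
    using assms sum.delta[of "{..<k}" 0 "\<lambda>_. 1::real"] by (simp add: power_0_left)
  then show "h_log k 0 = 0" using assms by (simp add: h_log_def ln_div)
  show "h_log k 1 = 0" using assms by (simp add: h_log_def)
qed

lemma continuous_on_h_log: "k \<ge> 1 \<Longrightarrow> continuous_on {0..1} (h_log k)"
  unfolding h_log_def[abs_def]
  by (intro continuous_intros) (use geom_sum_ge_1[of k] in \<open>force\<close>)+

lemma h_log_deriv:
  assumes k: "k \<ge> 1" and x: "0 < x" "x < 1"
  shows "(h_log k has_real_derivative log_der k x - ln (real k)) (at x)"
proof -
  let ?Q = "\<lambda>x::real. \<Sum>j<k. x ^ j"
  have Q1: "?Q x \<ge> 1" using geom_sum_ge_1 k x by simp
  have dQ: "(?Q has_real_derivative (\<Sum>j<k. real j * x ^ (j - 1))) (at x)"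
    by (intro DERIV_sum) (auto intro!: derivative_eq_intros)
  have eq: "(1 - t) * ?Q t = 1 - t ^ k" for t by (rule one_diff_power_eq[symmetric])
  have "((\<lambda>t. (1 - t) * ?Q t) has_real_derivative
      (1 - x) * (\<Sum>j<k. real j * x ^ (j - 1)) - ?Q x) (at x)"
    by (auto intro!: derivative_eq_intros dQ)
  moreover have "((\<lambda>t. 1 - t ^ k) has_real_derivative - (real k * x ^ (k - 1))) (at x)"
    by (auto intro!: derivative_eq_intros)
  ultimately have "(1 - x) * (\<Sum>j<k. real j * x ^ (j - 1)) - ?Q x = - (real k * x ^ (k - 1))"
    unfolding eq by (rule DERIV_unique)
  then have "block_poly k x = (1 - x) * (\<Sum>j<k. real j * x ^ (j - 1))"
    by (simp add: block_poly_def)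
  then have ld: "log_der k x = (\<Sum>j<k. real j * x ^ (j - 1)) / ?Q x"
    using x by (simp add: log_der_def flip: eq)
  have "?Q x / real k > 0" using Q1 k by simp
  then have "((\<lambda>t. ln (?Q t / real k)) has_real_derivative
      inverse (?Q x / real k) * ((\<Sum>j<k. real j * x ^ (j - 1)) / real k)) (at x)"
    by (intro DERIV_chain2[where f = ln] DERIV_ln DERIV_cdivide dQ)
  moreover have "inverse (?Q x / real k) * ((\<Sum>j<k. real j * x ^ (j - 1)) / real k) = log_der k x"
    unfolding ld using k by (simp add: divide_inverse)
  ultimately have "((\<lambda>t. ln (?Q t / real k)) has_real_derivative log_der k x) (at x)"
    by simp
  then have "((\<lambda>t. ln (?Q t / real k) + ln (real k) * (1 - t)) has_real_derivative
      log_der k x + ln (real k) * (0 - 1)) (at x)"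
    by (intro DERIV_add DERIV_cmult DERIV_diff DERIV_const DERIV_ident)
  then show ?thesis
    by (simp add: h_log_def[abs_def])
qed

lemma h_log_bound:
  assumes k: "k \<ge> 1" and x: "0 < x" "x < 1"
  shows "\<bar>h_log k x\<bar> \<le> (real k + ln (real k)) * x"
    and "\<bar>h_log k x\<bar> \<le> (real k + ln (real k)) * (1 - x)"
proof -
  have d: "\<bar>log_der k t - ln (real k)\<bar> \<le> real k + ln (real k)" if "0 < t" "t < 1" for t
    using log_der_bounds[OF that k] k ln_ge_zero[of "real k"] by linarith
  have mvt: "\<bar>h_log k b - h_log k a\<bar> \<le> (real k + ln (real k)) * (b - a)" if "0 \<le> a" "a < b" "b \<le> 1" for a b
  proof -
    have "continuous_on {a..b} (h_log k)"
      by (rule continuous_on_subset[OF continuous_on_h_log[OF k]]) (use that in auto)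
    moreover have "h_log k differentiable (at t)" if "a < t" "t < b" for t
      using h_log_deriv[OF k, of t] that \<open>0 \<le> a\<close> \<open>b \<le> 1\<close> by (auto simp: real_differentiable_def)
    ultimately obtain l z where z: "a < z" "z < b" "DERIV (h_log k) z :> l"
        "h_log k b - h_log k a = (b - a) * l"
      using MVT[OF \<open>a < b\<close>] by blast
    have "l = log_der k z - ln (real k)"
      using that z(1,2) by (intro DERIV_unique[OF z(3)] h_log_deriv[OF k]) auto
    then have "\<bar>l\<bar> \<le> real k + ln (real k)" using d[of z] z that by simp
    then show ?thesis using that by (simp add: z abs_mult mult.commute mult_left_mono)
  qed
  show "\<bar>h_log k x\<bar> \<le> (real k + ln (real k)) * x"
    using mvt[of 0 x] x h_log_ends[OF k] by simp
  show "\<bar>h_log k x\<bar> \<le> (real k + ln (real k)) * (1 - x)"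
    using mvt[of x 1] x h_log_ends[OF k] by simp
qed

lemma log_kernel_deriv:
  assumes "0 < x" "x < 1"
  shows "(log_kernel a has_vector_derivative - a * log_kernel (a - 1) x / of_real x) (at x)"
proof -
  have "((\<lambda>z. (- Ln z) powr a) has_field_derivative - a * (- Ln (of_real x)) powr (a - 1) / of_real x)
      (at (complex_of_real x))"
    using assms by (auto intro!: derivative_eq_intros simp: Ln_of_real complex_nonpos_Reals_iff field_simps)
  from has_vector_derivative_real_field[OF this, of UNIV]
  have "((\<lambda>t. (- Ln (of_real t)) powr a) has_vector_derivative
      - a * log_kernel (a - 1) x / of_real x) (at x)"
    using assms by (simp add: log_kernel_def Ln_of_real o_def)
  then show ?thesis
    by (rule has_vector_derivative_transform_within_open[of _ _ _ "{0<..}"])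
      (use assms in \<open>auto simp: log_kernel_def Ln_of_real\<close>)
qed

text \<open>At \<open>0\<close> the factor \<open>x\<close> from the first estimate of \<open>h_log_bound\<close> beats
  every power of the logarithm; at \<open>1\<close> the bound
  \<open>1 - x \<le> - ln x\<close> leaves \<open>(- ln x) powr (Re s)\<close>, which tends to \<open>0\<close>. The values at the two ends
  are \<open>0\<close> because \<open>h_log k\<close> vanishes there.\<close>

lemma continuous_on_log_kernel_h_log:
  assumes s: "Re s > 0" and k: "k \<ge> 1"
  shows "continuous_on {0..1} (\<lambda>x. log_kernel (s - 1) x * of_real (h_log k x))"
proof -
  let ?P = "\<lambda>x. log_kernel (s - 1) x * of_real (h_log k x)"
  let ?C = "real k + ln (real k)"
  have P: "cmod (?P x) = (- ln x) powr (Re s - 1) * \<bar>h_log k x\<bar>" if "0 < x" "x < 1" for x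
    using that by (simp add: norm_mult norm_log_kernel)
  have C: "?C \<ge> 0" using k by simp
  have "continuous_on {0<..<1} ?P"
    by (intro continuous_intros continuous_on_log_kernel continuous_on_of_real
        continuous_on_subset[OF continuous_on_h_log[OF k]]) auto
  then have mid: "continuous (at x within {0..1}) ?P" if "0 < x" "x < 1" for x
    using that by (metis continuous_at_imp_continuous_at_within continuous_on_eq_continuous_at
        greaterThanLessThan_iff open_greaterThanLessThan)
  have "((\<lambda>x. ?C * (x * (- ln x) powr (Re s - 1))) \<longlongrightarrow> 0) (at_right 0)"
    by real_asymp
  then have l0: "(?P \<longlongrightarrow> 0) (at_right 0)"
  proof (rule Lim_null_comparison[rotated])
    show "\<forall>\<^sub>F x in at_right 0. cmod (?P x) \<le> ?C * (x * (- ln x) powr (Re s - 1))"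
      using eventually_at_right_real[of 0 1, OF zero_less_one]
    proof eventually_elim
      case (elim x)
      then have x: "0 < x" "x < 1" by auto
      show ?case unfolding P[OF x]
        using mult_right_mono[OF h_log_bound(1)[OF k x], of "(- ln x) powr (Re s - 1)"]
        by (simp add: mult_ac)
    qed
  qed
  have "((\<lambda>x::real. - ln x) \<longlongrightarrow> 0) (at_left 1)" by real_asymp
  then have "((\<lambda>x. ?C * (- ln x) powr (Re s)) \<longlongrightarrow> ?C * 0) (at_left 1)"
    by (intro tendsto_mult tendsto_const tendsto_zero_powrI)
      (use s eventually_at_left_real[of 0 "1::real", OF zero_less_one] in \<open>auto elim!: eventually_mono\<close>)
  then have "((\<lambda>x. ?C * (- ln x) powr (Re s)) \<longlongrightarrow> 0) (at_left 1)"
    by (simp only: mult_zero_right)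
  then have l1: "(?P \<longlongrightarrow> 0) (at_left 1)"
  proof (rule Lim_null_comparison[rotated])
    show "\<forall>\<^sub>F x in at_left 1. cmod (?P x) \<le> ?C * (- ln x) powr (Re s)"
      using eventually_at_left_real[of 0 "1::real", OF zero_less_one]
    proof eventually_elim
      case (elim x)
      then have x: "0 < x" "x < 1" by auto
      have "1 - x \<le> - ln x" using ln_le_minus_one[OF x(1)] by simp
      then have "\<bar>h_log k x\<bar> \<le> ?C * (- ln x)"
        using h_log_bound(2)[OF k x] mult_left_mono[OF _ C] by (meson order_trans)
      then have "cmod (?P x) \<le> (- ln x) powr (Re s - 1) * (?C * (- ln x))"
        unfolding P[OF x] by (intro mult_left_mono) auto
      also have "\<dots> = ?C * (- ln x) powr (Re s)"
        using x by (simp add: powr_diff)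
      finally show ?case .
    qed
  qed
  show ?thesis
    unfolding continuous_on_eq_continuous_within
  proof
    fix x :: real assume "x \<in> {0..1}"
    then consider "x = 0" | "x = 1" | "0 < x" "x < 1" by fastforce
    then show "continuous (at x within {0..1}) ?P"
    proof cases
      case 1
      then show ?thesis using l0 h_log_ends[OF k]
        by (simp add: continuous_within at_within_Icc_at_right)
    next
      case 2
      then show ?thesis using l1 h_log_ends[OF k]
        by (simp add: continuous_within at_within_Icc_at_left)
    qed (rule mid)
  qed
qed

lemma h_fun_of_real:
  assumes k: "k \<ge> 1" and x: "0 \<le> x" "x < 1"
  shows "of_real (1 - x) * (h_fun k (of_real x) - h_fun k 0) = of_real (h_log k x)"
proof -
  have h0: "h_fun k 0 = - of_real (ln (real k))"
    using h_fun_log_branch(3)[OF k] by (simp add: h_fun_def)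
  have "(\<Sum>j<k. complex_of_real x ^ j) / of_nat k = of_real ((\<Sum>j<k. x ^ j) / real k)"
    by simp
  moreover have "(\<Sum>j<k. x ^ j) / real k > 0"
    using geom_sum_ge_1[OF k x(1)] k by simp
  ultimately have "Ln ((\<Sum>j<k. complex_of_real x ^ j) / of_nat k) = of_real (ln ((\<Sum>j<k. x ^ j) / real k))"
    using Ln_of_real by metis
  then have "of_real (1 - x) * h_fun k (of_real x) = of_real (ln ((\<Sum>j<k. x ^ j) / real k))"
    using x by (simp add: h_fun_def)
  then show ?thesis
    by (simp add: h0 h_log_def algebra_simps)
qed

text \<open>The coefficient functional \<open>\<Sum>n. a n * (n powr (1 - s) - (n + 1) powr (1 - s))\<close>, with
  \<open>0 powr (1 - s)\<close> read as \<open>0\<close>, sends \<open>h_fun k\<close> to \<open>(1 - k powr (1 - s)) * zeta s\<close>. On functions that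
  vanish at \<open>0\<close> it is integration against \<open>zeta_weight s x / (x * Gamma (s - 1))\<close>.\<close>

definition zeta_weight :: "complex \<Rightarrow> real \<Rightarrow> complex" where
  "zeta_weight s x = log_kernel (s - 2) x * of_real (1 - x)"

text \<open>Integration by parts turns the integral of \<open>log_kernel (s - 1) * log_der k\<close>, which is \<open>0\<close> at a zero
  of zeta, into an integral of the values of \<open>h_fun k\<close> on the radius. No derivative is left, so the
  resulting linear condition can survive a limit in \<open>H\<^sup>2\<close>.\<close>

lemma zeta_zero_functional_h_fun:
  assumes s: "Re s > 0" "s \<noteq> 1" and zero: "riemann_zeta s = 0" and k: "k \<ge> 1"
  shows "((\<lambda>x. (s - 1) * zeta_weight s x * ((h_fun k (of_real x) - h_fun k 0) / of_real x))
           has_integral Gamma s * h_fun k 0) {0<..<1}"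
proof -
  let ?P = "\<lambda>x. log_kernel (s - 1) x * of_real (h_log k x)"
  let ?P' = "\<lambda>x. log_kernel (s - 1) x * of_real (log_der k x - ln (real k))
     + (- (s - 1) * log_kernel (s - 1 - 1) x / of_real x) * of_real (h_log k x)"
  have "(?P' has_integral ?P 1 - ?P 0) {0..1}"
  proof (rule fundamental_theorem_of_calculus_interior)
    fix x :: real assume "x \<in> {0<..<1}"
    then have x: "0 < x" "x < 1" by auto
    have "((\<lambda>x. complex_of_real (h_log k x)) has_vector_derivative of_real (log_der k x - ln (real k))) (at x)"
      using h_log_deriv[OF k x]
      by (intro has_vector_derivative_of_real) (simp add: has_real_derivative_iff_has_vector_derivative)
    with log_kernel_deriv[OF x, of "s - 1"] show "(?P has_vector_derivative ?P' x) (at x)"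
      by (rule has_vector_derivative_mult)
  qed (use continuous_on_log_kernel_h_log[OF s(1) k] in auto)
  then have P: "(?P' has_integral 0) {0<..<1}"
    by (simp add: h_log_ends[OF k] has_integral_Icc_iff_Ioo)
  have "integral {0<..<1} (\<lambda>x. log_der k x *\<^sub>R log_kernel (s - 1) x) = 0"
    using log_der_integral_zeta[OF s k] zero by simp
  moreover have "(\<lambda>x. log_der k x *\<^sub>R log_kernel (s - 1) x) absolutely_integrable_on {0<..<1}"
    by (rule log_der_weighted_integral_sums(3)[OF k continuous_on_log_kernel
          log_kernel_absolutely_integrable[OF s(1)]])
  ultimately have L: "((\<lambda>x. log_der k x *\<^sub>R log_kernel (s - 1) x) has_integral 0) {0<..<1}"
    by (metis has_integral_integral set_lebesgue_integral_eq_integral(1))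
  \<comment> \<open>The linear correction in \<open>h_log\<close> has derivative \<open>- ln k\<close>; its kernel integral is the source of
    the term \<open>Gamma s * h_fun k 0\<close>.\<close>
  have M: "((\<lambda>x. of_real (ln (real k)) * (log_kernel (s - 1) x * of_real x ^ 0)) has_integral
      of_real (ln (real k)) * (Gamma s * of_nat (Suc 0) powr (- s))) {0<..<1}"
    by (intro has_integral_mult_right log_kernel_moment(2) s)
  have h0: "h_fun k 0 = - of_real (ln (real k))"
    using h_fun_log_branch(3)[OF k] by (simp add: h_fun_def)
  have "((\<lambda>x. (log_der k x *\<^sub>R log_kernel (s - 1) x
        - of_real (ln (real k)) * (log_kernel (s - 1) x * of_real x ^ 0)) - ?P' x) has_integral
      (0 - of_real (ln (real k)) * (Gamma s * of_nat (Suc 0) powr (- s))) - 0) {0<..<1}"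
    by (intro has_integral_diff L M P)
  then have "((\<lambda>x. (log_der k x *\<^sub>R log_kernel (s - 1) x
        - of_real (ln (real k)) * (log_kernel (s - 1) x * of_real x ^ 0)) - ?P' x) has_integral
      Gamma s * h_fun k 0) {0<..<1}"
    by (simp add: h0 mult.commute)
  then show ?thesis
  proof (rule has_integral_eq[rotated])
    fix x :: real assume "x \<in> {0<..<1}"
    then have x: "0 \<le> x" "x < 1" "x \<noteq> 0" by auto
    show "(log_der k x *\<^sub>R log_kernel (s - 1) x
        - of_real (ln (real k)) * (log_kernel (s - 1) x * of_real x ^ 0)) - ?P' x
      = (s - 1) * zeta_weight s x * ((h_fun k (of_real x) - h_fun k 0) / of_real x)"
      unfolding zeta_weight_def h_fun_of_real[OF k x(1,2), symmetric]
      using x(3) by (simp add: scaleR_conv_of_real field_simps)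
  qed
qed

lemma zeta_zero_functional:
  assumes s: "Re s > 0" "s \<noteq> 1" and zero: "riemann_zeta s = 0" and f: "f \<in> h_span"
  shows "((\<lambda>x. (s - 1) * zeta_weight s x * ((f (of_real x) - f 0) / of_real x))
           has_integral Gamma s * f 0) {0<..<1}"
proof -
  obtain K c where K: "finite K" "K \<subseteq> {2..}" "f = (\<lambda>z. \<Sum>k\<in>K. c k * h_fun k z)"
    using f unfolding h_span_def by blast
  have "((\<lambda>x. \<Sum>k\<in>K. c k * ((s - 1) * zeta_weight s x * ((h_fun k (of_real x) - h_fun k 0) / of_real x)))
      has_integral (\<Sum>k\<in>K. c k * (Gamma s * h_fun k 0))) {0<..<1}"
    using K by (intro has_integral_sum has_integral_mult_right zeta_zero_functional_h_fun s zero) auto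
  then show ?thesis
    unfolding K(3) by (simp add: sum_distrib_left sum_distrib_right sum_divide_distrib
        sum_subtractf[symmetric] algebra_simps diff_divide_distrib)
qed

lemma continuous_on_zeta_weight: "continuous_on {0<..<1} (zeta_weight s)"
  unfolding zeta_weight_def[abs_def] by (intro continuous_intros continuous_on_log_kernel)

text \<open>The factor \<open>1 - x \<le> - ln x\<close> of the weight cancels one order of the singularity at \<open>1\<close>. The
  resulting power of \<open>- ln x\<close> is integrable at both ends for \<open>Re s > 0\<close>.\<close>

lemma norm_zeta_weight_le:
  assumes "0 < x" "x < 1"
  shows "cmod (zeta_weight s x) \<le> (- ln x) powr (Re s - 1)"
proof -
  have "cmod (zeta_weight s x) = (- ln x) powr (Re s - 2) * (1 - x)"
    using assms by (simp add: zeta_weight_def norm_mult norm_log_kernel del: of_real_diff)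
  also have "\<dots> \<le> (- ln x) powr (Re s - 2) * (- ln x)"
    using ln_le_minus_one[OF assms(1)] by (intro mult_left_mono) auto
  also have "\<dots> = (- ln x) powr (Re s - 2) * (- ln x) powr 1"
    using assms by simp
  also have "\<dots> = (- ln x) powr (Re s - 2 + 1)"
    by (rule powr_add[symmetric])
  finally show ?thesis by simp
qed

lemma zeta_weight_nonzero: "0 < x \<Longrightarrow> x < 1 \<Longrightarrow> zeta_weight s x \<noteq> 0"
  by (simp add: zeta_weight_def log_kernel_def)

section \<open>The Fejer-Riesz inequality and means on circles\<close>

lemma circle_in_ball: "0 \<le> r \<Longrightarrow> r < 1 \<Longrightarrow> of_real r * cis t \<in> ball (0::complex) 1"
  by (simp add: norm_mult)

lemma continuous_on_circle:
  assumes "f holomorphic_on ball 0 1" "0 \<le> r" "r < 1"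
  shows "continuous_on A (\<lambda>t. f (of_real r * cis t))"
  by (rule continuous_on_compose2[OF holomorphic_on_imp_continuous_on[OF assms(1)]])
    (use circle_in_ball[OF assms(2,3)] in \<open>auto intro!: continuous_intros\<close>)

lemma hardy_mean_2_eq:
  "hardy_mean 2 f r = integral {0..2 * pi} (\<lambda>t. (cmod (f (of_real r * cis t)))\<^sup>2) / (2 * pi)"
  by (simp add: hardy_mean_def)

lemma circle_primitive_has_integral:
  assumes F: "\<And>z. z \<in> ball 0 1 \<Longrightarrow> (F has_field_derivative f z) (at z)"
    and r: "0 \<le> r" "r < 1" and ab: "a \<le> b"
  shows "((\<lambda>t. f (of_real r * cis t) * (of_real r * (\<i> * cis t))) has_integral
           F (of_real r * cis b) - F (of_real r * cis a)) {a..b}"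
proof (rule fundamental_theorem_of_calculus[OF ab])
  fix t
  have "((\<lambda>z. F (of_real r * exp (\<i> * z))) has_field_derivative
      f (of_real r * exp (\<i> * of_real t)) * (of_real r * (exp (\<i> * of_real t) * \<i>))) (at (of_real t))"
    by (rule DERIV_chain2[OF F]) (use circle_in_ball[OF r] in \<open>auto intro!: derivative_eq_intros simp: cis_conv_exp\<close>)
  from has_vector_derivative_real_field[OF this, of "{a..b}"]
  show "((\<lambda>t. F (of_real r * cis t)) has_vector_derivative
      f (of_real r * cis t) * (of_real r * (\<i> * cis t))) (at t within {a..b})"
    by (simp add: o_def cis_conv_exp mult_ac)
qed

lemma holomorphic_ball_primitive:
  assumes "f holomorphic_on ball 0 1"
  obtains F where "\<And>z. z \<in> ball 0 1 \<Longrightarrow> (F has_field_derivative f z) (at z)"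
  using holomorphic_convex_primitive'[OF convex_ball open_ball assms]
  by (metis at_within_open open_ball)

text \<open>The Fejer-Riesz inequality. The function \<open>A z * cnj (A (cnj z))\<close> is holomorphic and equals
  \<open>(cmod (A x))\<^sup>2\<close> on the diameter, so by Cauchy's theorem the integral over the diameter is the
  integral over the upper half circle. There the integrand is a product of values at conjugate
  points, and the arithmetic-geometric mean inequality bounds it by half the integral over the full
  circle.\<close>

lemma fejer_riesz:
  assumes A: "A holomorphic_on ball 0 1" and r: "0 \<le> r" "r < 1"
  shows "integral {0..r} (\<lambda>x. (cmod (A (of_real x)))\<^sup>2) \<le> pi * hardy_mean 2 A r"
proof -
  define f where "f = (\<lambda>z. A z * cnj (A (cnj z)))"
  have "cnj ` ball 0 1 = ball 0 1"
    by (auto intro: image_eqI[of _ cnj "cnj _"])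
  then have "cnj \<circ> A \<circ> cnj holomorphic_on ball 0 1"
    using A by (intro holomorphic_on_compose_cnj_cnj) auto
  then have "f holomorphic_on ball 0 1"
    unfolding f_def using A by (intro holomorphic_intros) (auto simp: o_def)
  then obtain F where F: "\<And>z. z \<in> ball 0 1 \<Longrightarrow> (F has_field_derivative f z) (at z)"
    by (rule holomorphic_ball_primitive) blast
  define u where "u = (\<lambda>t. (cmod (A (of_real r * cis t)))\<^sup>2)"
  have cu: "continuous_on S u" for S
    unfolding u_def by (intro continuous_intros continuous_on_circle A r)
  then have iu: "u integrable_on {a..b}" for a b
    by (intro integrable_continuous_real)
  have cA: "continuous_on {-r..r} (\<lambda>x. (cmod (A (of_real x)))\<^sup>2)"
    by (intro continuous_intros continuous_on_compose2[OF holomorphic_on_imp_continuous_on[OF A]])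
      (use r in auto)
  have "((\<lambda>x. f (of_real x)) has_integral F (of_real r) - F (of_real (- r))) {-r..r}"
  proof (rule fundamental_theorem_of_calculus)
    fix x assume "x \<in> {-r..r}"
    then have "(F has_field_derivative f (of_real x)) (at (of_real x))"
      using r by (intro F) auto
    from has_vector_derivative_real_field[OF this, of "{-r..r}"]
    show "((\<lambda>x. F (of_real x)) has_vector_derivative f (of_real x)) (at x within {-r..r})"
      by (simp add: o_def)
  qed (use r in auto)
  moreover have "f (of_real x) = of_real ((cmod (A (of_real x)))\<^sup>2)" for x
    unfolding f_def by (simp only: complex_cnj_complex_of_real complex_norm_square)
  ultimately have I: "((\<lambda>x. of_real ((cmod (A (of_real x)))\<^sup>2)) has_integral F (of_real r) - F (of_real (- r))) {-r..r}"
    by (simp only:)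
  have line: "integral {-r..r} (\<lambda>x. (cmod (A (of_real x)))\<^sup>2) = Re (F (of_real r) - F (of_real (- r)))"
    using has_integral_Re[OF I] by (simp add: integral_unique)
  have J: "((\<lambda>t. f (of_real r * cis t) * (of_real r * (\<i> * cis t))) has_integral F (of_real (- r)) - F (of_real r)) {0..pi}"
    using circle_primitive_has_integral[OF F r pi_ge_zero] by simp
  have "cmod (F (of_real (- r)) - F (of_real r)) \<le> integral {0..pi} (\<lambda>t. r / 2 * (u t + u (- t)))"
    unfolding integral_unique[OF J, symmetric]
  proof (rule integral_norm_bound_integral)
    show "(\<lambda>t. f (of_real r * cis t) * (of_real r * (\<i> * cis t))) integrable_on {0..pi}"
      using J by blast
    show "(\<lambda>t. r / 2 * (u t + u (- t))) integrable_on {0..pi}"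
      by (intro integrable_continuous_real continuous_intros cu continuous_on_compose2[OF cu[of UNIV]]) auto
    fix t
    have "cnj (of_real r * cis t) = of_real r * cis (- t)"
      by (simp only: complex_cnj_mult complex_cnj_complex_of_real cis_cnj)
    then have "f (of_real r * cis t) = A (of_real r * cis t) * cnj (A (of_real r * cis (- t)))"
      by (simp only: f_def)
    then have "cmod (f (of_real r * cis t) * (of_real r * (\<i> * cis t)))
        = r * (cmod (A (of_real r * cis t)) * cmod (A (of_real r * cis (- t))))"
      using r by (simp add: norm_mult)
    also have "\<dots> \<le> r * ((u t + u (- t)) / 2)"
      using sum_squares_bound[of "cmod (A (of_real r * cis t))" "cmod (A (of_real r * cis (- t)))"] r
      by (intro mult_left_mono) (auto simp: u_def)
    finally show "cmod (f (of_real r * cis t) * (of_real r * (\<i> * cis t))) \<le> r / 2 * (u t + u (- t))"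
      by simp
  qed
  also have "\<dots> = r / 2 * (integral {0..pi} u + integral {0..pi} (\<lambda>t. u (- t)))"
    using iu has_integral_reflect_real
    by (subst integral_mult_right, subst Henstock_Kurzweil_Integration.integral_add)
      (auto intro!: integrable_continuous_real continuous_on_compose2[OF cu[of UNIV]] continuous_intros)
  also have "integral {0..pi} (\<lambda>t. u (- t)) = integral {-pi..0} u"
    using Henstock_Kurzweil_Integration.integral_reflect_real[of 0 "-pi" u] by simp
  also have "\<dots> = integral {pi..2 * pi} u"
  proof -
    have "u (x + 2 * pi) = u x" for x by (simp add: u_def flip: cis_mult)
    then show ?thesis using integral_shift_real_ivl[of pi "2 * pi" "2 * pi" u] by simp
  qed
  also have "integral {0..pi} u + integral {pi..2 * pi} u = integral {0..2 * pi} u"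
    by (intro Henstock_Kurzweil_Integration.integral_combine iu) auto
  also have "r / 2 * integral {0..2 * pi} u \<le> 1 / 2 * integral {0..2 * pi} u"
    using r by (intro mult_right_mono Henstock_Kurzweil_Integration.integral_nonneg iu) (auto simp: u_def)
  also have "\<dots> = pi * hardy_mean 2 A r"
    by (simp add: hardy_mean_2_eq u_def)
  finally have bound: "cmod (F (of_real (- r)) - F (of_real r)) \<le> pi * hardy_mean 2 A r" .
  have "integral {0..r} (\<lambda>x. (cmod (A (of_real x)))\<^sup>2) \<le> integral {-r..r} (\<lambda>x. (cmod (A (of_real x)))\<^sup>2)"
    using r by (intro integral_subset_le integrable_continuous_real cA continuous_on_subset[OF cA]) auto
  also have "\<dots> \<le> cmod (F (of_real r) - F (of_real (- r)))"
    unfolding line by (rule complex_Re_le_cmod)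
  also have "\<dots> \<le> pi * hardy_mean 2 A r"
    using bound by (simp add: norm_minus_commute)
  finally show ?thesis .
qed

text \<open>Monotone convergence along the radii \<open>1 - 1 / (n + 2)\<close>, which stay above the threshold \<open>1 / 2\<close>.\<close>

lemma improper_integral_nonneg_bounded:
  fixes u :: "real \<Rightarrow> real"
  assumes u: "continuous_on {0..<1} u" "\<And>x. 0 \<le> x \<Longrightarrow> x < 1 \<Longrightarrow> 0 \<le> u x"
    and C: "\<And>r. 1/2 \<le> r \<Longrightarrow> r < 1 \<Longrightarrow> integral {0..r} u \<le> C"
  shows "u integrable_on {0<..<1}" "integral {0<..<1} u \<le> C"
proof -
  define c where "c n = 1 - 1 / real (n + 2)" for n
  define f where "f n x = (if x \<in> {0..c n} then u x else 0)" for n x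
  define g where "g x = (if x < 1 then u x else 0)" for x
  have c: "1/2 \<le> c n" "c n < 1" for n by (auto simp: c_def field_simps)
  have cmono: "c n \<le> c (Suc n)" for n by (simp add: c_def field_simps)
  have clim: "c \<longlonglongrightarrow> 1" unfolding c_def by real_asymp
  have ui: "u integrable_on {0..c n}" for n
    using c[of n] by (intro integrable_continuous_real continuous_on_subset[OF u(1)]) auto
  have fi: "(f n has_integral integral {0..c n} u) {0..1}" for n
    unfolding f_def[abs_def] using c[of n] ui by (subst has_integral_restrict) auto
  have ipos: "0 \<le> integral {0..c n} u" for n
    using c[of n] u(2) by (intro Henstock_Kurzweil_Integration.integral_nonneg ui) auto
  have "g integrable_on {0..1} \<and> (\<lambda>n. integral {0..1} (f n)) \<longlonglongrightarrow> integral {0..1} g"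
  proof (rule monotone_convergence_increasing)
    show "f n integrable_on {0..1}" for n using fi by blast
    show "f n x \<le> f (Suc n) x" if "x \<in> {0..1}" for n x
      using cmono[of n] c[of "Suc n"] u(2)[of x] that by (auto simp: f_def)
    show "bounded (range (\<lambda>n. integral {0..1} (f n)))"
      using C[OF c] ipos unfolding integral_unique[OF fi] bounded_iff
      by (auto intro!: exI[of _ C])
    show "(\<lambda>n. f n x) \<longlonglongrightarrow> g x" if x: "x \<in> {0..1}" for x
    proof (cases "x < 1")
      case True
      have "eventually (\<lambda>n. c n > x) sequentially"
        using order_tendstoD(1)[OF clim True] .
      then have "eventually (\<lambda>n. f n x = g x) sequentially"
        by eventually_elim (use x True in \<open>auto simp: f_def g_def\<close>)
      then show ?thesis by (rule tendsto_eventually)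
    next
      case False
      then have "f n x = g x" for n using c[of n] by (auto simp: f_def g_def)
      then show ?thesis by simp
    qed
  qed
  then have g: "g integrable_on {0..1}" "(\<lambda>n. integral {0..1} (f n)) \<longlonglongrightarrow> integral {0..1} g" by auto
  have "integral {0..1} g \<le> C"
    by (rule LIMSEQ_le_const2[OF g(2)]) (use C[OF c] in \<open>auto simp: integral_unique[OF fi]\<close>)
  moreover have "(g has_integral integral {0..1} g) {0<..<1}"
    using integrable_integral[OF g(1)] by (simp only: has_integral_Icc_iff_Ioo)
  then have "(u has_integral integral {0..1} g) {0<..<1}"
    by (rule has_integral_eq[rotated]) (auto simp: g_def)
  ultimately show "u integrable_on {0<..<1}" "integral {0<..<1} u \<le> C"
    by (auto simp: integral_unique)
qed

lemma continuous_on_radius: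
  assumes "A holomorphic_on ball 0 1"
  shows "continuous_on {0..<1} (\<lambda>x. A (of_real x))"
  by (rule continuous_on_compose2[OF holomorphic_on_imp_continuous_on[OF assms]])
    (auto intro!: continuous_intros)

text \<open>Only radii near \<open>1\<close> matter. For divided differences the means are controlled by a factor
  \<open>1 / r\<^sup>2\<close>, hence the restriction to \<open>r \<ge> 1 / 2\<close> in the hypothesis.\<close>

lemma fejer_riesz_radius:
  assumes A: "A holomorphic_on ball 0 1"
    and M: "\<And>r. 1/2 \<le> r \<Longrightarrow> r < 1 \<Longrightarrow> hardy_mean 2 A r \<le> M"
  shows "(\<lambda>x. (cmod (A (of_real x)))\<^sup>2) integrable_on {0<..<1}"
    and "integral {0<..<1} (\<lambda>x. (cmod (A (of_real x)))\<^sup>2) \<le> pi * M"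
proof -
  have "integral {0..r} (\<lambda>x. (cmod (A (of_real x)))\<^sup>2) \<le> pi * M" if "1/2 \<le> r" "r < 1" for r
    using that by (intro order_trans[OF fejer_riesz[OF A]] mult_left_mono M) auto
  moreover have "continuous_on {0..<1} (\<lambda>x. (cmod (A (of_real x)))\<^sup>2)"
    by (intro continuous_intros continuous_on_radius A)
  ultimately show "(\<lambda>x. (cmod (A (of_real x)))\<^sup>2) integrable_on {0<..<1}"
      "integral {0<..<1} (\<lambda>x. (cmod (A (of_real x)))\<^sup>2) \<le> pi * M"
    using improper_integral_nonneg_bounded[of "\<lambda>x. (cmod (A (of_real x)))\<^sup>2" "pi * M"] by auto
qed

definition divided_difference :: "(complex \<Rightarrow> complex) \<Rightarrow> complex \<Rightarrow> complex" where
  "divided_difference A z = (if z = 0 then deriv A 0 else (A z - A 0) / z)"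

lemma divided_difference_holomorphic:
  assumes "A holomorphic_on ball 0 1"
  shows "divided_difference A holomorphic_on ball 0 1"
  using pole_lemma_open[OF assms open_ball, of 0]
  unfolding divided_difference_def[abs_def] diff_zero .

text \<open>On the circle of radius \<open>r\<close> one has \<open>r * cmod (divided_difference A z) = cmod (A z - A 0)\<close>, and
  \<open>A - A 0\<close> is orthogonal to constants, so that Pythagoras gives
  \<open>hardy_mean 2 A r - (cmod (A 0))\<^sup>2\<close> for its mean square.\<close>

lemma hardy_mean_divided_difference:
  assumes A: "A holomorphic_on ball 0 1" and r: "0 < r" "r < 1"
  shows "hardy_mean 2 (divided_difference A) r \<le> hardy_mean 2 A r / r\<^sup>2"
proof -
  let ?D = "divided_difference A"
  let ?z = "\<lambda>t. complex_of_real r * cis t"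
  have r': "0 \<le> r" using r by simp
  obtain F where F: "\<And>z. z \<in> ball 0 1 \<Longrightarrow> (F has_field_derivative ?D z) (at z)"
    using holomorphic_ball_primitive[OF divided_difference_holomorphic[OF A]] by blast
  have zD: "?z t * ?D (?z t) = A (?z t) - A 0" for t
    using r by (simp add: divided_difference_def)
  \<comment> \<open>Cauchy's theorem for the divided difference says that \<open>A - A 0\<close> has mean \<open>0\<close> on the circle.\<close>
  have "((\<lambda>t. ?D (?z t) * (of_real r * (\<i> * cis t))) has_integral F (?z (2 * pi)) - F (?z 0)) {0..2 * pi}"
    by (rule circle_primitive_has_integral[OF F r' r(2)]) auto
  moreover have "?D (?z t) * (of_real r * (\<i> * cis t)) = \<i> * (?z t * ?D (?z t))" for t
    by (simp add: mult_ac)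
  ultimately have "((\<lambda>t. \<i> * (?z t * ?D (?z t))) has_integral 0) {0..2 * pi}"
    by simp
  then have "((\<lambda>t. (- \<i> * cnj (A 0)) * (\<i> * (A (?z t) - A 0))) has_integral (- \<i> * cnj (A 0)) * 0) {0..2 * pi}"
    unfolding zD by (rule has_integral_mult_right)
  then have "((\<lambda>t. cnj (A 0) * (A (?z t) - A 0)) has_integral 0) {0..2 * pi}"
    by (simp add: mult.assoc[symmetric] mult_ac)
  from has_integral_Re[OF this]
  have orth: "((\<lambda>t. Re (cnj (A 0) * (A (?z t) - A 0))) has_integral 0) {0..2 * pi}" by simp
  have mean: "((\<lambda>t. (cmod (A (?z t)))\<^sup>2) has_integral integral {0..2 * pi} (\<lambda>t. (cmod (A (?z t)))\<^sup>2)) {0..2 * pi}"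
    by (intro integrable_integral integrable_continuous_real continuous_intros continuous_on_circle A r r')
  have pyth: "(cmod (?D (?z t)))\<^sup>2 * r\<^sup>2
      = (cmod (A (?z t)))\<^sup>2 - 2 * Re (cnj (A 0) * (A (?z t) - A 0)) - (cmod (A 0))\<^sup>2" for t
  proof -
    have "(cmod (?D (?z t)))\<^sup>2 * r\<^sup>2 = (cmod (?z t * ?D (?z t)))\<^sup>2"
      by (simp add: norm_mult power_mult_distrib)
    also have "\<dots> = (cmod (A (?z t) - A 0))\<^sup>2" by (simp only: zD)
    also have "\<dots> = (cmod (A (?z t)))\<^sup>2 - 2 * Re (cnj (A 0) * (A (?z t) - A 0)) - (cmod (A 0))\<^sup>2"
      unfolding cmod_power2 by (simp add: algebra_simps power2_eq_square)
    finally show ?thesis .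
  qed
  have "((\<lambda>t. (cmod (?D (?z t)))\<^sup>2 * r\<^sup>2) has_integral
      integral {0..2 * pi} (\<lambda>t. (cmod (A (?z t)))\<^sup>2) - 2 * 0 - 2 * pi * (cmod (A 0))\<^sup>2) {0..2 * pi}"
    unfolding pyth
    using has_integral_const_real[of "(cmod (A 0))\<^sup>2" 0 "2 * pi"]
    by (intro has_integral_diff has_integral_mult_right orth mean) simp
  then have "integral {0..2 * pi} (\<lambda>t. (cmod (?D (?z t)))\<^sup>2) * r\<^sup>2
      = integral {0..2 * pi} (\<lambda>t. (cmod (A (?z t)))\<^sup>2) - 2 * pi * (cmod (A 0))\<^sup>2"
    by (simp add: has_integral_iff)
  then have "integral {0..2 * pi} (\<lambda>t. (cmod (?D (?z t)))\<^sup>2) * r\<^sup>2 \<le> integral {0..2 * pi} (\<lambda>t. (cmod (A (?z t)))\<^sup>2)"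
    by simp
  then show ?thesis
    using r by (simp add: hardy_mean_2_eq field_simps)
qed

lemma hardy_mean_2_zero: "hardy_mean 2 A 0 = (cmod (A 0))\<^sup>2"
  by (simp add: hardy_mean_2_eq)

lemma hardy_space_iff:
  "B \<in> hardy_space p \<longleftrightarrow> B holomorphic_on ball 0 1 \<and>
     (\<exists>M. \<forall>r. 0 \<le> r \<longrightarrow> r < 1 \<longrightarrow> hardy_mean p B r \<le> M)"
proof -
  have "bdd_above (hardy_mean p B ` {0..<1}) \<longleftrightarrow> (\<exists>M. \<forall>r\<in>{0..<1}. hardy_mean p B r \<le> M)"
    unfolding bdd_above_def ball_simps(9) by (rule refl)
  then show ?thesis by (auto simp: hardy_space_def Ball_def)
qed

text \<open>Without zeros, \<open>B\<close> has a holomorphic power \<open>G\<close> of exponent \<open>p / 2\<close>, and \<open>G\<close> lies in \<open>H\<^sup>2\<close>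
  because \<open>(cmod (G z))\<^sup>2 = cmod (B z) powr p\<close>. This reduces the inequality for \<open>H\<^sup>p\<close> to the
  quadratic one.\<close>

lemma hardy_space_radius_integrable:
  assumes B: "B \<in> hardy_space p" and nz: "\<And>z. z \<in> ball 0 1 \<Longrightarrow> B z \<noteq> 0"
  shows "(\<lambda>x. cmod (B (of_real x)) powr p) integrable_on {0<..<1}"
proof -
  have hol: "B holomorphic_on ball 0 1" using B by (simp add: hardy_space_def)
  obtain M where M: "\<And>r. 0 \<le> r \<Longrightarrow> r < 1 \<Longrightarrow> hardy_mean p B r \<le> M"
    using B unfolding hardy_space_iff by blast
  obtain L where L: "L holomorphic_on ball 0 1" "\<And>z. z \<in> ball 0 1 \<Longrightarrow> B z = exp (L z)"
    using contractible_imp_holomorphic_log[OF hol convex_imp_contractible[OF convex_ball] nz] by blast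
  define G where "G = (\<lambda>z. exp (of_real (p / 2) * L z))"
  have G: "G holomorphic_on ball 0 1"
    unfolding G_def by (intro holomorphic_intros L)
  have eq: "(cmod (G z))\<^sup>2 = cmod (B z) powr p" if "z \<in> ball 0 1" for z
  proof -
    have "(cmod (G z))\<^sup>2 = exp (p * Re (L z))"
      by (simp add: G_def power2_eq_square flip: exp_add)
    also have "\<dots> = cmod (B z) powr p"
      by (simp add: L(2)[OF that] powr_def)
    finally show ?thesis .
  qed
  have "hardy_mean 2 G r = hardy_mean p B r" if "0 \<le> r" "r < 1" for r
    unfolding hardy_mean_2_eq hardy_mean_def using eq[OF circle_in_ball[OF that]] by simp
  then have "(\<lambda>x. (cmod (G (of_real x)))\<^sup>2) integrable_on {0<..<1}"
    using M by (intro fejer_riesz_radius[OF G, of M]) auto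
  then show ?thesis
    by (rule integrable_eq) (auto simp: eq)
qed

lemma hardy_mean_diff_le:
  assumes "f holomorphic_on ball 0 1" "g holomorphic_on ball 0 1" "0 \<le> r" "r < 1"
  shows "hardy_mean 2 (\<lambda>z. f z - g z) r \<le> 2 * hardy_mean 2 f r + 2 * hardy_mean 2 g r"
proof -
  let ?z = "\<lambda>t. complex_of_real r * cis t"
  have int: "(\<lambda>t. (cmod (h (?z t)))\<^sup>2) integrable_on {0..2 * pi}" if "h holomorphic_on ball 0 1" for h
    by (intro integrable_continuous_real continuous_intros continuous_on_circle that assms)
  have "(cmod (a - b))\<^sup>2 \<le> 2 * (cmod a)\<^sup>2 + 2 * (cmod b)\<^sup>2" for a b :: complex
  proof -
    have "(cmod (a - b))\<^sup>2 \<le> (cmod a + cmod b)\<^sup>2"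
      by (intro power_mono norm_triangle_ineq4) auto
    then show ?thesis using sum_squares_bound[of "cmod a" "cmod b"] by (simp add: power2_sum)
  qed
  then have "integral {0..2 * pi} (\<lambda>t. (cmod (f (?z t) - g (?z t)))\<^sup>2)
      \<le> integral {0..2 * pi} (\<lambda>t. 2 * (cmod (f (?z t)))\<^sup>2 + 2 * (cmod (g (?z t)))\<^sup>2)"
    by (intro integral_le int[of "\<lambda>z. f z - g z"] integrable_add integrable_on_mult_right int
        holomorphic_intros assms) auto
  also have "\<dots> = 2 * integral {0..2 * pi} (\<lambda>t. (cmod (f (?z t)))\<^sup>2)
      + 2 * integral {0..2 * pi} (\<lambda>t. (cmod (g (?z t)))\<^sup>2)"
    by (subst Henstock_Kurzweil_Integration.integral_add)
      (auto intro!: integrable_on_mult_right int assms)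
  finally show ?thesis
    by (simp add: hardy_mean_2_eq field_simps)
qed

lemma hardy_space_2_diff:
  assumes "f \<in> hardy_space 2" "g \<in> hardy_space 2"
  shows "(\<lambda>z. f z - g z) \<in> hardy_space 2"
proof -
  have hol: "f holomorphic_on ball 0 1" "g holomorphic_on ball 0 1"
    using assms by (auto simp: hardy_space_def)
  obtain M where M: "\<And>r. 0 \<le> r \<Longrightarrow> r < 1 \<Longrightarrow> hardy_mean 2 f r \<le> M"
    using assms(1) unfolding hardy_space_iff by blast
  obtain N where N: "\<And>r. 0 \<le> r \<Longrightarrow> r < 1 \<Longrightarrow> hardy_mean 2 g r \<le> N"
    using assms(2) unfolding hardy_space_iff by blast
  have "hardy_mean 2 (\<lambda>z. f z - g z) r \<le> 2 * M + 2 * N" if "0 \<le> r" "r < 1" for r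
    using hardy_mean_diff_le[OF hol that] M[OF that] N[OF that] by simp
  then show ?thesis
    unfolding hardy_space_iff using hol by (blast intro: holomorphic_on_diff)
qed

lemma hardy_mean_le_of_hardy_norm:
  assumes F: "F \<in> hardy_space 2" and e: "hardy_norm 2 F < e" and r: "0 \<le> r" "r < 1"
  shows "hardy_mean 2 F r \<le> e\<^sup>2"
proof -
  let ?S = "SUP r\<in>{0..<1}. hardy_mean 2 F r"
  have bdd: "bdd_above (hardy_mean 2 F ` {0..<1})" using F by (simp add: hardy_space_def)
  have le: "hardy_mean 2 F t \<le> ?S" if "t \<in> {0..<1}" for t
    by (rule cSUP_upper[OF that bdd])
  have "0 \<le> hardy_mean 2 F 0" by (simp add: hardy_mean_2_zero)
  then have S: "0 \<le> ?S" using le[of 0] by simp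
  have "sqrt ?S < e" using e S by (simp add: hardy_norm_def powr_half_sqrt)
  then have "?S \<le> e\<^sup>2"
    using S power_mono[of "sqrt ?S" e 2] by simp
  then show ?thesis using le[of r] r by simp
qed

lemma monomial_in_hardy_space: "(\<lambda>z. z ^ n) \<in> hardy_space 2"
proof -
  have "hardy_mean 2 (\<lambda>z. z ^ n) r \<le> 1" if "0 \<le> r" "r < 1" for r
  proof -
    have "hardy_mean 2 (\<lambda>z. z ^ n) r = (r ^ n)\<^sup>2"
      using that by (simp add: hardy_mean_2_eq norm_mult norm_power)
    then show ?thesis using that by (simp add: power_le_one)
  qed
  then show ?thesis
    unfolding hardy_space_iff by (intro conjI exI[of _ 1] holomorphic_intros) auto
qed

section \<open>Vanishing moments\<close>

text \<open>The integral of \<open>m\<close> against every polynomial is \<open>0\<close>, hence by the Weierstrass theorem against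
  every continuous function on the closed interval. The function \<open>m\<close> itself need not extend
  continuously to the end points, but the test function \<open>x * (1 - x) * m x / (1 + \<bar>m x\<bar>)\<close> does; it has
  the sign of \<open>m\<close>, so a vanishing integral forces \<open>m = 0\<close>.\<close>

lemma vanishing_moments_real:
  fixes m :: "real \<Rightarrow> real"
  assumes cont: "continuous_on {0<..<1} m" and int: "m absolutely_integrable_on {0<..<1}"
    and mom: "\<And>n. integral {0<..<1} (\<lambda>x. m x * x ^ n) = 0"
    and x: "0 < x" "x < 1"
  shows "m x = 0"
proof -
  define \<psi> where "\<psi> = (\<lambda>x. if 0 < x \<and> x < 1 then x * (1 - x) * (m x / (1 + \<bar>m x\<bar>)) else 0)"
  have pos: "1 + \<bar>m x\<bar> \<noteq> 0" for x by linarith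
  have bound: "\<bar>\<psi> x\<bar> \<le> x * (1 - x)" if "x \<in> {0..1}" for x
  proof -
    have "\<bar>m x / (1 + \<bar>m x\<bar>)\<bar> \<le> 1" by (simp add: abs_divide divide_le_eq)
    then show ?thesis
      using that mult_left_mono[of "\<bar>m x / (1 + \<bar>m x\<bar>)\<bar>" 1 "x * (1 - x)"]
      by (auto simp: \<psi>_def abs_mult)
  qed
  have c\<psi>: "continuous_on {0<..<1} \<psi>"
    by (subst continuous_on_cong[OF refl, of _ \<psi> "\<lambda>x. x * (1 - x) * (m x / (1 + \<bar>m x\<bar>))"])
      (auto simp: \<psi>_def intro!: continuous_intros cont pos)
  have cpsi: "continuous_on {0..1} \<psi>"
    unfolding continuous_on_eq_continuous_within
  proof
    fix t :: real assume t: "t \<in> {0..1}"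
    show "continuous (at t within {0..1}) \<psi>"
    proof (cases "t \<in> {0<..<1}")
      case True
      then show ?thesis
        using c\<psi> by (metis continuous_at_imp_continuous_at_within continuous_on_eq_continuous_at
            open_greaterThanLessThan)
    next
      case False
      then have "t * (1 - t) = 0" "\<psi> t = 0" using t by (auto simp: \<psi>_def)
      moreover have "((\<lambda>x. x * (1 - x)) \<longlongrightarrow> t * (1 - t)) (at t within {0..1})"
        by (intro tendsto_intros)
      ultimately have lim: "((\<lambda>x. x * (1 - x)) \<longlongrightarrow> 0) (at t within {0..1})" by (simp only:)
      have "(\<psi> \<longlongrightarrow> 0) (at t within {0..1})"
        by (rule Lim_null_comparison[OF _ lim])
          (use bound in \<open>auto simp: eventually_at_filter\<close>)
      then show ?thesis using \<open>\<psi> t = 0\<close> by (simp add: continuous_within)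
    qed
  qed
  define K where "K = integral {0<..<1} (\<lambda>x. \<bar>m x\<bar>)"
  have mi: "m integrable_on {0<..<1}" and ami: "(\<lambda>x. \<bar>m x\<bar>) integrable_on {0<..<1}"
    using int by (auto simp: absolutely_integrable_on_def)
  have K: "K \<ge> 0" unfolding K_def by (intro Henstock_Kurzweil_Integration.integral_nonneg ami) auto
  have mxn: "(\<lambda>x. m x * x ^ n) integrable_on {0<..<1}" for n
  proof -
    have "(\<lambda>x. m x * x ^ n) absolutely_integrable_on {0<..<1}"
    proof (rule continuous_bounded_imp_absolutely_integrable[OF _ ami])
      show "norm (m x * x ^ n) \<le> \<bar>m x\<bar>" if "0 < x" "x < 1" for x
        using that by (simp add: abs_mult mult_left_le power_le_one)
    qed (intro continuous_intros cont)
    then show ?thesis using set_lebesgue_integral_eq_integral(1) by blast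
  qed
  have m\<psi>: "(\<lambda>x. m x * \<psi> x) integrable_on {0<..<1}"
  proof -
    have "(\<lambda>x. m x * \<psi> x) absolutely_integrable_on {0<..<1}"
    proof (rule continuous_bounded_imp_absolutely_integrable[OF _ ami])
      show "norm (m x * \<psi> x) \<le> \<bar>m x\<bar>" if "0 < x" "x < 1" for x
      proof -
        have "x * (1 - x) \<le> 1 * 1" using that by (intro mult_mono) auto
        then have "\<bar>\<psi> x\<bar> \<le> 1" using bound[of x] that by simp
        then show ?thesis by (simp add: abs_mult mult_left_le)
      qed
    qed (intro continuous_intros cont c\<psi>)
    then show ?thesis using set_lebesgue_integral_eq_integral(1) by blast
  qed
  have nonneg: "0 \<le> m x * \<psi> x" for x
  proof -
    have "m x * \<psi> x = (if 0 < x \<and> x < 1 then x * (1 - x) * ((m x)\<^sup>2 / (1 + \<bar>m x\<bar>)) else 0)"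
      by (simp add: \<psi>_def power2_eq_square)
    then show ?thesis by simp
  qed
  have small: "integral {0<..<1} (\<lambda>x. m x * \<psi> x) \<le> K * e" if e: "e > 0" for e
  proof -
    obtain p where p: "real_polynomial_function p" "\<And>x. x \<in> {0..1} \<Longrightarrow> \<bar>\<psi> x - p x\<bar> < e"
      using Stone_Weierstrass_real_polynomial_function[OF _ cpsi e] by auto
    then obtain a N where pa: "p = (\<lambda>x. \<Sum>i\<le>N. a i * x ^ i)"
      unfolding real_polynomial_function_iff_sum by blast
    have "((\<lambda>x. \<Sum>i\<le>N. a i * (m x * x ^ i)) has_integral (\<Sum>i\<le>N. a i * 0)) {0<..<1}"
      using mxn mom by (intro has_integral_sum has_integral_mult_right) (auto simp: has_integral_iff)
    then have mp: "((\<lambda>x. m x * p x) has_integral 0) {0<..<1}"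
      by (simp add: pa sum_distrib_left mult_ac)
    have "integral {0<..<1} (\<lambda>x. m x * \<psi> x) = integral {0<..<1} (\<lambda>x. m x * \<psi> x - m x * p x)"
      using mp m\<psi> by (subst Henstock_Kurzweil_Integration.integral_diff) (auto simp: has_integral_iff)
    also have "\<dots> \<le> integral {0<..<1} (\<lambda>x. \<bar>m x\<bar> * e)"
    proof (rule integral_le)
      show "(\<lambda>x. m x * \<psi> x - m x * p x) integrable_on {0<..<1}"
        using mp m\<psi> by (intro integrable_diff) auto
      show "(\<lambda>x. \<bar>m x\<bar> * e) integrable_on {0<..<1}" using ami by (intro integrable_on_mult_left)
      fix x :: real assume "x \<in> {0<..<1}"
      then have "\<bar>\<psi> x - p x\<bar> \<le> e" using p(2)[of x] by simp
      then have "\<bar>m x\<bar> * \<bar>\<psi> x - p x\<bar> \<le> \<bar>m x\<bar> * e" by (intro mult_left_mono) auto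
      moreover have "m x * (\<psi> x - p x) \<le> \<bar>m x\<bar> * \<bar>\<psi> x - p x\<bar>"
        by (metis abs_ge_self abs_mult)
      ultimately show "m x * \<psi> x - m x * p x \<le> \<bar>m x\<bar> * e" by (simp add: right_diff_distrib)
    qed
    also have "\<dots> = K * e" by (simp add: K_def)
    finally show ?thesis .
  qed
  have total: "integral {0<..<1} (\<lambda>x. m x * \<psi> x) \<le> 0"
  proof (rule field_le_epsilon)
    fix e :: real assume "e > 0"
    moreover have "K * (e / (K + 1)) \<le> e" using K \<open>e > 0\<close> by (simp add: field_simps)
    ultimately show "integral {0<..<1} (\<lambda>x. m x * \<psi> x) \<le> 0 + e"
      using small[of "e / (K + 1)"] K by simp
  qed
  define a where "a = x / 2"
  define b where "b = (x + 1) / 2"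
  have ab: "0 < a" "a < x" "x < b" "b < 1" using x by (auto simp: a_def b_def)
  have cab: "continuous_on {a..b} (\<lambda>x. m x * \<psi> x)"
    using ab by (intro continuous_intros continuous_on_subset[OF cont] continuous_on_subset[OF c\<psi>]) auto
  have "integral {a..b} (\<lambda>x. m x * \<psi> x) \<le> integral {0<..<1} (\<lambda>x. m x * \<psi> x)"
    using ab nonneg by (intro integral_subset_le integrable_continuous_real cab m\<psi>) auto
  moreover have "0 \<le> integral {a..b} (\<lambda>x. m x * \<psi> x)"
    by (intro Henstock_Kurzweil_Integration.integral_nonneg integrable_continuous_real cab nonneg)
  ultimately have "integral {a..b} (\<lambda>x. m x * \<psi> x) = 0" using total by simp
  then have "((\<lambda>x. m x * \<psi> x) has_integral 0) (cbox a b)"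
    using integrable_integral[OF integrable_continuous_real[OF cab]] by simp
  then have "m x * \<psi> x = 0"
    using ab cab nonneg by (intro has_integral_0_cbox_imp_0[of a b "\<lambda>x. m x * \<psi> x"]) auto
  then show ?thesis using x pos[of x] by (auto simp: \<psi>_def)
qed

lemma vanishing_moments:
  fixes M :: "real \<Rightarrow> complex"
  assumes cont: "continuous_on {0<..<1} M" and int: "M absolutely_integrable_on {0<..<1}"
    and mom: "\<And>n. ((\<lambda>x. M x * of_real x ^ n) has_integral 0) {0<..<1}"
    and x: "0 < x" "x < 1"
  shows "M x = 0"
proof (rule complex_eqI)
  have nM: "(\<lambda>x. cmod (M x)) integrable_on {0<..<1}"
    using int by (auto simp: absolutely_integrable_on_def)
  show "Re (M x) = Re 0"
    using has_integral_Re[OF mom] x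
    by (simp, intro vanishing_moments_real[of "\<lambda>x. Re (M x)"]
        continuous_bounded_imp_absolutely_integrable[OF _ nM] continuous_intros cont)
      (auto simp: abs_Re_le_cmod integral_unique simp flip: of_real_power)
  show "Im (M x) = Im 0"
    using has_integral_Im[OF mom] x
    by (simp, intro vanishing_moments_real[of "\<lambda>x. Im (M x)"]
        continuous_bounded_imp_absolutely_integrable[OF _ nM] continuous_intros cont)
      (auto simp: abs_Im_le_cmod integral_unique simp flip: of_real_power)
qed

section \<open>Passing to the limit in \<open>H\<^sup>2\<close>\<close>

lemma bounded_on_half_radius:
  assumes "A holomorphic_on ball 0 1"
  shows "\<exists>C\<ge>0. \<forall>x\<in>{0..1/2}. cmod (A (complex_of_real x)) \<le> C"
proof -
  have "compact ((\<lambda>x. A (complex_of_real x)) ` {0..1/2})"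
    by (intro compact_continuous_image continuous_on_subset[OF continuous_on_radius[OF assms]]) auto
  then have "bounded ((\<lambda>x. A (complex_of_real x)) ` {0..1/2})"
    by (rule compact_imp_bounded)
  then obtain C where C: "C > 0" "\<And>y. y \<in> (\<lambda>x. A (complex_of_real x)) ` {0..1/2} \<Longrightarrow> cmod y \<le> C"
    unfolding bounded_pos by auto
  then show ?thesis
    by (intro exI[of _ C]) simp
qed

text \<open>Choose \<open>f\<close> in the span with \<open>F z = z ^ Suc n - \<phi> z * f z\<close> small in \<open>H\<^sup>2\<close>, so that
  \<open>f = B * (z ^ Suc n - F)\<close>. The product rule for divided differences gives
  \<open>(f x - f 0) / x = B x * x ^ n - B x * divided_difference F x - F 0 * divided_difference B x\<close>.
  Integrating this against the weight, the left side is a multiple of \<open>f 0 = - B 0 * F 0\<close> because zeta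
  vanishes at \<open>s\<close>, the last term is a multiple of \<open>F 0\<close>, and the middle term is small because
  \<open>divided_difference F\<close> is small in \<open>L\<^sup>2\<close> of the radius by the Fejer-Riesz inequality. So the
  \<open>n\<close>-th moment is arbitrarily small.\<close>

lemma zeta_zero_moments_vanish:
  assumes dense: "dense_in_H2 {(\<lambda>z. \<phi> z * f z) | f. f \<in> h_span}"
    and B: "B holomorphic_on ball 0 1" "\<And>z. z \<in> ball 0 1 \<Longrightarrow> B z * \<phi> z = 1"
    and s: "Re s > 0" "s \<noteq> 1" and zero: "riemann_zeta s = 0"
    and WB2: "(\<lambda>x. (cmod (zeta_weight s x * B (of_real x)))\<^sup>2) integrable_on {0<..<1}"
  shows "((\<lambda>x. zeta_weight s x * B (of_real x) * of_real x ^ n) has_integral 0) {0<..<1}"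
    and "(\<lambda>x. zeta_weight s x * B (of_real x)) absolutely_integrable_on {0<..<1}"
proof -
  let ?W = "zeta_weight s"
  let ?b = "\<lambda>x::real. B (of_real x)"
  let ?D = "divided_difference"
  have rad: "continuous_on {0<..<1} (\<lambda>x. A (complex_of_real x))" if "A holomorphic_on ball 0 1" for A
    by (rule continuous_on_subset[OF continuous_on_radius[OF that]]) auto
  have W: "(\<lambda>x. cmod (?W x)) integrable_on {0<..<1}"
  proof -
    have "?W absolutely_integrable_on {0<..<1}"
      by (rule continuous_bounded_imp_absolutely_integrable[OF continuous_on_zeta_weight
            log_powr_integrable norm_zeta_weight_le]) (use s in auto)
    then show ?thesis by (simp add: absolutely_integrable_on_def)
  qed
  have cWB: "continuous_on {0<..<1} (\<lambda>x. ?W x * ?b x)"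
    by (intro continuous_intros continuous_on_zeta_weight rad B)
  have one: "(\<lambda>x::real. 1::real) integrable_on {0<..<1}"
    by (rule integrable_eq[OF log_powr_integrable[of 0]]) auto
  show WB: "(\<lambda>x. ?W x * ?b x) absolutely_integrable_on {0<..<1}"
  proof (rule continuous_bounded_imp_absolutely_integrable[OF cWB])
    show "(\<lambda>x. 1 + (cmod (?W x * ?b x))\<^sup>2) integrable_on {0<..<1}"
      by (intro integrable_add one WB2)
    have "y \<le> 1 + y\<^sup>2" for y :: real
      using sum_squares_bound[of 1 y] zero_le_power2[of y]
      unfolding power_one mult_1_right by linarith
    then show "norm (?W x * ?b x) \<le> 1 + (cmod (?W x * ?b x))\<^sup>2" for x by blast
  qed
  have nWB: "(\<lambda>x. cmod (?W x * ?b x)) integrable_on {0<..<1}"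
    using WB by (simp add: absolutely_integrable_on_def)
  have WBn: "(\<lambda>x. ?W x * ?b x * of_real x ^ n) integrable_on {0<..<1}"
  proof -
    have "(\<lambda>x. ?W x * ?b x * of_real x ^ n) absolutely_integrable_on {0<..<1}"
    proof (rule continuous_bounded_imp_absolutely_integrable[OF _ nWB])
      show "norm (?W x * ?b x * of_real x ^ n) \<le> cmod (?W x * ?b x)" if "0 < x" "x < 1" for x
        using that by (simp add: norm_mult norm_power mult_left_le power_le_one)
    qed (intro continuous_intros cWB)
    then show ?thesis using set_lebesgue_integral_eq_integral(1) by blast
  qed
  have DB: "?D B holomorphic_on ball 0 1" by (rule divided_difference_holomorphic[OF B(1)])
  have WDB: "(\<lambda>x. ?W x * ?D B (of_real x)) integrable_on {0<..<1}"
  proof -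
    obtain C where C0: "C \<ge> 0" and C: "\<forall>x\<in>{0..1/2}. cmod (?D B (complex_of_real x)) \<le> C"
      using bounded_on_half_radius[OF DB] by blast
    \<comment> \<open>Compactness near \<open>0\<close>, where the quotient has a removable singularity; the definition of the
      divided difference elsewhere.\<close>
    have le: "cmod (?D B (of_real x)) \<le> (C + 2 * cmod (B 0)) + 2 * cmod (?b x)" if "0 < x" "x < 1" for x
    proof (cases "x \<le> 1/2")
      case True
      have "cmod (?D B (of_real x)) \<le> C" using True C that by simp
      then show ?thesis by (simp add: add_increasing2)
    next
      case False
      have "cmod (?D B (of_real x)) = cmod (?b x - B 0) * (1 / x)"
        using that by (simp add: divided_difference_def norm_divide)
      also have "\<dots> \<le> (cmod (?b x) + cmod (B 0)) * 2"
        using False that by (intro mult_mono norm_triangle_ineq4) (auto simp: field_simps)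
      finally show ?thesis using C0 by (simp add: algebra_simps)
    qed
    have "(\<lambda>x. ?W x * ?D B (of_real x)) absolutely_integrable_on {0<..<1}"
    proof (rule continuous_bounded_imp_absolutely_integrable)
      show "(\<lambda>x. (C + 2 * cmod (B 0)) * cmod (?W x) + 2 * cmod (?W x * ?b x)) integrable_on {0<..<1}"
        by (intro integrable_add integrable_on_mult_right W nWB)
      show "norm (?W x * ?D B (of_real x)) \<le> (C + 2 * cmod (B 0)) * cmod (?W x) + 2 * cmod (?W x * ?b x)"
        if "0 < x" "x < 1" for x
        using mult_left_mono[OF le[OF that] norm_ge_zero[of "?W x"]]
        by (simp add: norm_mult algebra_simps)
    qed (intro continuous_intros continuous_on_zeta_weight rad DB)
    then show ?thesis using set_lebesgue_integral_eq_integral(1) by blast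
  qed
  define J where "J = integral {0<..<1} (\<lambda>x. ?W x * ?b x * of_real x ^ n)"
  define K where "K = integral {0<..<1} (\<lambda>x. (cmod (?W x * ?b x))\<^sup>2)"
  define L where "L = integral {0<..<1} (\<lambda>x. ?W x * ?D B (of_real x))"
  define R where "R = cmod (Gamma s) * cmod (B 0) + cmod (s - 1) * (K / 2 + 2 * pi) + cmod (s - 1) * cmod L"
  have K: "K \<ge> 0" unfolding K_def by (intro Henstock_Kurzweil_Integration.integral_nonneg WB2) auto
  have R: "R \<ge> 0" using K by (simp add: R_def)
  have main: "cmod ((s - 1) * J) \<le> e * R" if e: "e > 0" for e
  proof -
    have "\<exists>g\<in>{(\<lambda>z. \<phi> z * f z) | f. f \<in> h_span}. hardy_norm 2 (\<lambda>z. z ^ Suc n - g z) < e"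
      using dense[unfolded dense_in_H2_def, THEN conjunct2, rule_format,
          OF monomial_in_hardy_space e, of "Suc n"] .
    then obtain g where g: "g \<in> {(\<lambda>z. \<phi> z * f z) | f. f \<in> h_span}"
      and ge: "hardy_norm 2 (\<lambda>z. z ^ Suc n - g z) < e" by (rule bexE)
    obtain f where f: "f \<in> h_span" and gf: "g = (\<lambda>z. \<phi> z * f z)"
      using g by (elim CollectE exE conjE)
    have fH: "(\<lambda>z. \<phi> z * f z) \<in> hardy_space 2"
      using subsetD[OF dense[unfolded dense_in_H2_def, THEN conjunct1] g] by (simp only: gf)
    have fe: "hardy_norm 2 (\<lambda>z. z ^ Suc n - \<phi> z * f z) < e"
      using ge by (simp only: gf)
    define F where "F = (\<lambda>z. z ^ Suc n - \<phi> z * f z)"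
    have FH: "F \<in> hardy_space 2"
      unfolding F_def by (rule hardy_space_2_diff[OF monomial_in_hardy_space fH])
    then have holF: "F holomorphic_on ball 0 1" by (simp add: hardy_space_def)
    have meanF: "hardy_mean 2 F r \<le> e\<^sup>2" if "0 \<le> r" "r < 1" for r
      using hardy_mean_le_of_hardy_norm[OF FH _ that] fe by (simp add: F_def)
    have F0: "cmod (F 0) \<le> e"
      using meanF[of 0] e by (simp add: hardy_mean_2_zero abs_le_square_iff[symmetric])
    have DF: "?D F holomorphic_on ball 0 1" by (rule divided_difference_holomorphic[OF holF])
    have meanDF: "hardy_mean 2 (?D F) r \<le> 4 * e\<^sup>2" if "1/2 \<le> r" "r < 1" for r
    proof -
      have "hardy_mean 2 (?D F) r \<le> hardy_mean 2 F r / r\<^sup>2"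
        using that by (intro hardy_mean_divided_difference holF) auto
      also have "\<dots> \<le> e\<^sup>2 / (1/2)\<^sup>2"
        using that meanF[of r] by (intro frac_le power_mono) auto
      finally show ?thesis by (simp add: power2_eq_square)
    qed
    note FR = fejer_riesz_radius[OF DF meanDF]
    \<comment> \<open>Cauchy-Schwarz in the form \<open>p * q \<le> e / 2 * p\<^sup>2 + 1 / (2 * e) * q\<^sup>2\<close>; the integral of \<open>q\<^sup>2\<close> is of
    order \<open>e\<^sup>2\<close>, so both terms are of order \<open>e\<close>.\<close>
    let ?g = "\<lambda>x. e / 2 * (cmod (?W x * ?b x))\<^sup>2 + 1 / (2 * e) * (cmod (?D F (of_real x)))\<^sup>2"
    have gi: "?g integrable_on {0<..<1}"
      by (intro integrable_add integrable_on_mult_right WB2 FR(1))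
    have le: "cmod (?W x * ?b x * ?D F (of_real x)) \<le> ?g x" for x
    proof -
      let ?p = "cmod (?W x * ?b x)" and ?q = "cmod (?D F (of_real x))"
      have "0 \<le> (e * ?p - ?q)\<^sup>2 / (2 * e)" using e by simp
      also have "\<dots> = e / 2 * ?p\<^sup>2 + 1 / (2 * e) * ?q\<^sup>2 - ?p * ?q"
        using e by (simp add: power2_diff field_simps power2_eq_square)
      finally show ?thesis by (simp only: norm_mult) 
    qed
    have "(\<lambda>x. ?W x * ?b x * ?D F (of_real x)) absolutely_integrable_on {0<..<1}"
      by (rule continuous_bounded_imp_absolutely_integrable[OF _ gi le])
        (intro continuous_intros continuous_on_zeta_weight rad B DF)
    then have Ni: "(\<lambda>x. ?W x * ?b x * ?D F (of_real x)) integrable_on {0<..<1}"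
      using set_lebesgue_integral_eq_integral(1) by blast
    define N where "N = integral {0<..<1} (\<lambda>x. ?W x * ?b x * ?D F (of_real x))"
    have "cmod N \<le> integral {0<..<1} ?g"
      unfolding N_def by (rule integral_norm_bound_integral[OF Ni gi le])
    also have "\<dots> = e / 2 * K + 1 / (2 * e) * integral {0<..<1} (\<lambda>x. (cmod (?D F (of_real x)))\<^sup>2)"
      unfolding K_def
      by (intro integral_unique has_integral_add has_integral_mult_right integrable_integral WB2 FR(1))
    also have "\<dots> \<le> e / 2 * K + 1 / (2 * e) * (pi * (4 * e\<^sup>2))"
      using e FR(2) by (intro add_left_mono mult_left_mono) auto
    also have "\<dots> = e * (K / 2 + 2 * pi)"
      using e by (simp add: field_simps power2_eq_square)
    finally have N: "cmod N \<le> e * (K / 2 + 2 * pi)" .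
    have fB: "f z = B z * (z ^ Suc n - F z)" if "z \<in> ball 0 1" for z
      using B(2)[OF that] by (simp add: F_def mult.assoc[symmetric])
    have f0: "f 0 = - (B 0 * F 0)" using fB[of 0] by simp
    have I1: "((\<lambda>x. (s - 1) * ?W x * ((f (of_real x) - f 0) / of_real x)) has_integral Gamma s * f 0) {0<..<1}"
      by (rule zeta_zero_functional[OF s zero f])
    have I2: "((\<lambda>x. (s - 1) * ((?W x * ?b x * of_real x ^ n - ?W x * ?b x * ?D F (of_real x))
        - F 0 * (?W x * ?D B (of_real x)))) has_integral (s - 1) * ((J - N) - F 0 * L)) {0<..<1}"
      unfolding J_def N_def L_def
      by (intro has_integral_mult_right has_integral_diff integrable_integral WBn Ni WDB)
    have split: "(s - 1) * ?W x * ((f (of_real x) - f 0) / of_real x)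
        = (s - 1) * ((?W x * ?b x * of_real x ^ n - ?W x * ?b x * ?D F (of_real x))
        - F 0 * (?W x * ?D B (of_real x)))" if "x \<in> {0<..<1}" for x
    proof -
      have x: "of_real x \<in> ball (0::complex) 1" "x \<noteq> 0" using that by auto
      have eq: "(f (of_real x) - f 0) / of_real x
          = ?b x * of_real x ^ n - ?b x * ?D F (of_real x) - F 0 * ?D B (of_real x)"
        unfolding f0 fB[OF x(1)] using x(2)
        by (simp add: divided_difference_def field_simps)
      show ?thesis unfolding eq by (simp add: algebra_simps)
    qed
    have "Gamma s * f 0 = (s - 1) * ((J - N) - F 0 * L)"
      by (rule has_integral_unique[OF has_integral_eq[OF split I1] I2])
    then have J: "(s - 1) * J = Gamma s * f 0 + (s - 1) * N + (s - 1) * (F 0 * L)"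
      by (simp add: algebra_simps)
    have "cmod ((s - 1) * J) \<le> cmod (Gamma s * f 0) + cmod ((s - 1) * N) + cmod ((s - 1) * (F 0 * L))"
      unfolding J by (intro norm_triangle_le add_right_mono norm_triangle_ineq)
    also have "\<dots> \<le> cmod (Gamma s) * (cmod (B 0) * e) + cmod (s - 1) * (e * (K / 2 + 2 * pi))
        + cmod (s - 1) * (e * cmod L)"
      unfolding f0 norm_mult norm_minus_cancel
      by (intro add_mono mult_left_mono mult_right_mono N F0) auto
    also have "\<dots> = e * R" by (simp add: R_def algebra_simps)
    finally show ?thesis .
  qed
  have "cmod ((s - 1) * J) \<le> 0"
  proof (rule field_le_epsilon)
    fix e :: real assume "e > 0"
    moreover have "e / (R + 1) * R \<le> e" using R \<open>e > 0\<close> by (simp add: field_simps)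
    ultimately show "cmod ((s - 1) * J) \<le> 0 + e"
      using main[of "e / (R + 1)"] R by simp
  qed
  then have "J = 0" using s(2) by simp
  then show "((\<lambda>x. ?W x * ?b x * of_real x ^ n) has_integral 0) {0<..<1}"
    using integrable_integral[OF WBn] by (simp add: J_def)
qed

text \<open>The powers of \<open>z\<close> alone already give all moments of the function \<open>zeta_weight s * B\<close>, and this
  function has no zeros on the open radius.\<close>

lemma zeta_nonzero_of_weight_square_integrable:
  assumes dense: "dense_in_H2 {(\<lambda>z. \<phi> z * f z) | f. f \<in> h_span}"
    and B: "B holomorphic_on ball 0 1" "\<And>z. z \<in> ball 0 1 \<Longrightarrow> B z * \<phi> z = 1"
    and s: "Re s > 0" "s \<noteq> 1"
    and WB2: "(\<lambda>x. (cmod (zeta_weight s x * B (of_real x)))\<^sup>2) integrable_on {0<..<1}"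
  shows "riemann_zeta s \<noteq> 0"
proof
  assume zero: "riemann_zeta s = 0"
  note van = zeta_zero_moments_vanish[OF dense B s zero WB2]
  have "continuous_on {0<..<1} (\<lambda>x. zeta_weight s x * B (of_real x))"
    by (intro continuous_intros continuous_on_zeta_weight
        continuous_on_subset[OF continuous_on_radius[OF B(1)]]) auto
  then have "zeta_weight s (1/2) * B (of_real (1/2)) = 0"
    by (rule vanishing_moments[OF _ van(2) van(1)]) auto
  moreover have "B (of_real (1/2)) \<noteq> 0"
    using B(2)[of "of_real (1/2)"] by (auto simp: norm_divide)
  ultimately show False using zeta_weight_nonzero[of "1/2" s] by simp
qed

section \<open>Square integrability of the weighted reciprocal\<close>

lemma weight_square_integrable:
  assumes B: "B holomorphic_on ball 0 1" and g: "g integrable_on {0<..<1}"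
    and le: "\<And>x. 0 < x \<Longrightarrow> x < 1 \<Longrightarrow> (- ln x) powr (2 * Re s - 2) * (cmod (B (of_real x)))\<^sup>2 \<le> g x"
  shows "(\<lambda>x. (cmod (zeta_weight s x * B (of_real x)))\<^sup>2) integrable_on {0<..<1}"
proof -
  have "(\<lambda>x. (cmod (zeta_weight s x * B (of_real x)))\<^sup>2) absolutely_integrable_on {0<..<1}"
  proof (rule continuous_bounded_imp_absolutely_integrable[OF _ g])
    show "continuous_on {0<..<1} (\<lambda>x. (cmod (zeta_weight s x * B (of_real x)))\<^sup>2)"
      by (intro continuous_intros continuous_on_zeta_weight
          continuous_on_subset[OF continuous_on_radius[OF B]]) auto
    fix x :: real assume x: "0 < x" "x < 1"
    have "(cmod (zeta_weight s x))\<^sup>2 \<le> ((- ln x) powr (Re s - 1))\<^sup>2"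
      by (intro power_mono norm_zeta_weight_le x) auto
    also have "\<dots> = (- ln x) powr (2 * Re s - 2)"
      by (simp add: power2_eq_square flip: powr_add)
    finally show "norm ((cmod (zeta_weight s x * B (of_real x)))\<^sup>2) \<le> g x"
      using order_trans[OF mult_right_mono le[OF x]] by (simp add: norm_mult power_mult_distrib)
  qed
  then show ?thesis using set_lebesgue_integral_eq_integral(1) by blast
qed

text \<open>Young's inequality with exponents \<open>p / 2\<close> and \<open>q = p / (p - 2)\<close> separates \<open>(cmod (B x)) powr p\<close>,
  integrable by the Fejer-Riesz inequality, from \<open>(- ln x) powr ((2 * Re s - 2) * q)\<close>. The latter
  is integrable iff its exponent exceeds \<open>- 1\<close>, which is the condition \<open>Re s > 1 / 2 + 1 / p\<close>.\<close>

lemma weight_square_integrable_hardy: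
  assumes B: "B \<in> hardy_space p" "\<And>z. z \<in> ball 0 1 \<Longrightarrow> B z \<noteq> 0"
    and p: "p > 2" and s: "Re s > 1 / 2 + 1 / p"
  shows "(\<lambda>x. (cmod (zeta_weight s x * B (of_real x)))\<^sup>2) integrable_on {0<..<1}"
proof -
  define q where "q = p / (p - 2)"
  have q: "q > 1" using p by (simp add: q_def)
  have pq: "1 / (p / 2) + 1 / q = 1" using p by (simp add: q_def field_simps)
  have "(2 * Re s - 2) * q > -1"
  proof -
    have "2 * Re s - 2 > - (1 - 2 / p)" using s by simp
    also have "1 - 2 / p = 1 / q" using pq p by simp
    finally show ?thesis using q by (simp add: field_simps)
  qed
  then have "(\<lambda>x. (cmod (B (of_real x)) powr p) / (p / 2) + (- ln x) powr ((2 * Re s - 2) * q) / q)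
      integrable_on {0<..<1}"
    by (intro integrable_add integrable_on_divide hardy_space_radius_integrable B log_powr_integrable)
  then show ?thesis
  proof (rule weight_square_integrable[rotated])
    show "B holomorphic_on ball 0 1" using B by (simp add: hardy_space_def)
    fix x :: real assume x: "0 < x" "x < 1"
    let ?b = "(cmod (B (of_real x)))\<^sup>2" and ?w = "(- ln x) powr (2 * Re s - 2)"
    have "?b * ?w \<le> ?b powr (p / 2) / (p / 2) + ?w powr q / q"
      using p q pq by (intro Youngs_inequality) auto
    moreover have "?b powr (p / 2) = cmod (B (of_real x)) powr p"
      using B(2)[of "of_real x"] x powr_powr[of "cmod (B (of_real x))" 2 "p / 2"] by simp
    ultimately show "?w * ?b \<le> (cmod (B (of_real x)) powr p) / (p / 2) + (- ln x) powr ((2 * Re s - 2) * q) / q"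
      by (simp add: powr_powr mult.commute)
  qed
qed

lemma weight_square_integrable_bounded:
  assumes B: "B \<in> hardy_space_infinity" and s: "Re s > 1 / 2"
  shows "(\<lambda>x. (cmod (zeta_weight s x * B (of_real x)))\<^sup>2) integrable_on {0<..<1}"
proof -
  have "bounded (B ` ball 0 1)" using B by (simp add: hardy_space_infinity_def)
  then obtain C where "\<forall>z\<in>ball 0 1. cmod (B z) \<le> C"
    unfolding bounded_iff by auto
  then have C: "cmod (B z) \<le> C" if "z \<in> ball 0 1" for z using that by blast
  show ?thesis
  proof (rule weight_square_integrable)
    show "B holomorphic_on ball 0 1" using B by (simp add: hardy_space_infinity_def)
    show "(\<lambda>x. (- ln x) powr (2 * Re s - 2) * C\<^sup>2) integrable_on {0<..<1}"
      using s by (intro integrable_on_mult_left log_powr_integrable) auto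
    show "(- ln x) powr (2 * Re s - 2) * (cmod (B (of_real x)))\<^sup>2 \<le> (- ln x) powr (2 * Re s - 2) * C\<^sup>2"
      if "0 < x" "x < 1" for x
      using that by (intro mult_left_mono power_mono C) auto
  qed
qed

text \<open>For \<open>Re s \<ge> 1\<close> the weight is bounded near \<open>1\<close>, where \<open>- ln x \<le> 1\<close> for \<open>x \<ge> 1 / 2\<close>, so there the
  integrability of \<open>(cmod (B x))\<^sup>2\<close> suffices. Near \<open>0\<close>, where the weight can be unbounded, \<open>B\<close> is
  bounded.\<close>

lemma weight_square_integrable_hardy_2:
  assumes B: "B \<in> hardy_space 2" "\<And>z. z \<in> ball 0 1 \<Longrightarrow> B z \<noteq> 0" and s: "Re s \<ge> 1"
  shows "(\<lambda>x. (cmod (zeta_weight s x * B (of_real x)))\<^sup>2) integrable_on {0<..<1}"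
proof -
  have hol: "B holomorphic_on ball 0 1" using B by (simp add: hardy_space_def)
  obtain C where "C \<ge> 0" and C: "\<forall>x\<in>{0..1/2}. cmod (B (complex_of_real x)) \<le> C"
    using bounded_on_half_radius[OF hol] by blast
  have B2: "(\<lambda>x. (cmod (B (of_real x)))\<^sup>2) integrable_on {0<..<1}"
    using hardy_space_radius_integrable[OF B] by simp
  show ?thesis
  proof (rule weight_square_integrable[OF hol])
    show "(\<lambda>x. (- ln x) powr (2 * Re s - 2) * C\<^sup>2 + (cmod (B (of_real x)))\<^sup>2) integrable_on {0<..<1}"
      using s by (intro integrable_add integrable_on_mult_left log_powr_integrable B2) auto
    fix x :: real assume x: "0 < x" "x < 1"
    show "(- ln x) powr (2 * Re s - 2) * (cmod (B (of_real x)))\<^sup>2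
        \<le> (- ln x) powr (2 * Re s - 2) * C\<^sup>2 + (cmod (B (of_real x)))\<^sup>2"
    proof (cases "x \<le> 1/2")
      case True
      then have "(- ln x) powr (2 * Re s - 2) * (cmod (B (of_real x)))\<^sup>2 \<le> (- ln x) powr (2 * Re s - 2) * C\<^sup>2"
        using x C by (intro mult_left_mono power_mono) auto
      then show ?thesis by (simp add: add_increasing2)
    next
      case False
      have "ln (1 / x) \<le> 1 / x - 1" using x by (intro ln_le_minus_one) auto
      then have "- ln x \<le> 1 / x - 1" using x by (simp add: ln_div)
      also have "\<dots> \<le> 1" using False x by (simp add: field_simps)
      finally have "(- ln x) powr (2 * Re s - 2) \<le> 1 powr (2 * Re s - 2)"
        using x s by (intro powr_mono2) auto
      then have "(- ln x) powr (2 * Re s - 2) * (cmod (B (of_real x)))\<^sup>2 \<le> 1 * (cmod (B (of_real x)))\<^sup>2"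
        by (intro mult_right_mono) auto
      moreover have "0 \<le> (- ln x) powr (2 * Re s - 2) * C\<^sup>2" by simp
      ultimately show ?thesis by linarith
    qed
  qed
qed

section \<open>Zero-free half-planes\<close>

theorem theorem14:
  fixes \<phi> :: "complex \<Rightarrow> complex"
  assumes "smirnov_unit \<phi>"
    and "dense_in_H2 {(\<lambda>z. \<phi> z * f z) | f. f \<in> h_span}"
  shows "(\<forall>p::real. p > 2 \<and> (\<lambda>z. 1 / \<phi> z) \<in> hardy_space p \<longrightarrow>
            (\<forall>s. Re s > 1 / 2 + 1 / p \<and> s \<noteq> 1 \<longrightarrow> riemann_zeta s \<noteq> 0)) \<and>
         ((\<lambda>z. 1 / \<phi> z) \<in> hardy_space 2 \<longrightarrow>
            (\<forall>s. Re s \<ge> 1 \<and> s \<noteq> 1 \<longrightarrow> riemann_zeta s \<noteq> 0)) \<and>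
         ((\<lambda>z. 1 / \<phi> z) \<in> hardy_space_infinity \<longrightarrow>
            (\<forall>s. Re s > 1 / 2 \<and> s \<noteq> 1 \<longrightarrow> riemann_zeta s \<noteq> 0))"
proof -
  let ?B = "\<lambda>z. 1 / \<phi> z"
  have nz: "\<phi> z \<noteq> 0" if "z \<in> ball 0 1" for z
    using assms(1) that by (simp add: smirnov_unit_def)
  have inv: "?B z * \<phi> z = 1" and Bnz: "?B z \<noteq> 0" if "z \<in> ball 0 1" for z
    using nz[OF that] by auto
  have key: "riemann_zeta s \<noteq> 0"
    if "?B holomorphic_on ball 0 1" "Re s > 0" "s \<noteq> 1"
      "(\<lambda>x. (cmod (zeta_weight s x * ?B (of_real x)))\<^sup>2) integrable_on {0<..<1}" for s
    using zeta_nonzero_of_weight_square_integrable[OF assms(2) that(1) inv that(2-4)] .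
  show ?thesis
  proof (intro conjI allI impI; elim conjE)
    fix p :: real and s
    assume p: "p > 2" "?B \<in> hardy_space p" and s: "Re s > 1 / 2 + 1 / p" "s \<noteq> 1"
    have "1 / p > 0" using p by simp
    then have "Re s > 0" using s by linarith
    then show "riemann_zeta s \<noteq> 0"
      using p s by (intro key weight_square_integrable_hardy[OF p(2) Bnz p(1)]) (auto simp: hardy_space_def)
  next
    fix s assume "?B \<in> hardy_space 2" "Re s \<ge> 1" "s \<noteq> 1"
    then show "riemann_zeta s \<noteq> 0"
      by (intro key weight_square_integrable_hardy_2 Bnz) (auto simp: hardy_space_def)
  next
    fix s assume "?B \<in> hardy_space_infinity" "Re s > 1 / 2" "s \<noteq> 1"
    then show "riemann_zeta s \<noteq> 0"
      by (intro key weight_square_integrable_bounded) (auto simp: hardy_space_infinity_def)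
  qed
qed

end
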